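(* Let $\mathcal I$ be a small direct category and $\Sigma$ an $\mathcal I$-sorted signature of some dimension $\alpha$. For every $\Sigma$-computad $C$, the free $\Sigma$-algebra $\mathrm K_\Sigma C$ on $C$ is cofibrant.
   Context: **Conventions.** $\mathcal I$ is a small direct category: a small category with a function $\dim:\mathrm{ob}\,\mathcal I\to\mathrm{Ord}$ such that $\dim j<\dim i$ whenever there is a non-identity morphism $j\to i$. Its objects are called sorts and its morphisms face maps. For a presheaf $X$ we write $X_i$ for its value at $i$ and $\delta^*:X_i\to X_j$ for the action of $\delta:j\to i$. $\mathcal I_\beta$ is the full subcategory of sorts of dimension $\le\beta$, and $\mathrm{tr}_\beta$ denotes restriction of presheaves to $\mathcal I_\beta$. **Signatures, computads, terms.** The following are defined simultaneously by transfinite recursion on an ordinal $\alpha$: the class of ($\mathcal I$-sorted) signatures $\Sigma$ of dimension $\alpha$, with restrictions $\Sigma_\beta$ of dimension $\beta$ for $\beta\le\alpha$; for each such $\Sigma$ a category $\mathrm{Comp}_\Sigma$ of $\Sigma$-computads with truncation functors $\mathrm{tr}^\Sigma_\beta:\mathrm{Comp}_\Sigma\to\mathrm{Comp}_{\Sigma_\beta}$, written $C\mapsto C_\beta$, $\sigma\mapsto\sigma_\beta$; and an adjunction $\mathrm{Cptd}_\Sigma\dashv\mathrm{Term}_\Sigma$ with $\mathrm{Cptd}_\Sigma:[\mathcal I_\alpha^{\mathrm{op}},\mathrm{Set}]\to\mathrm{Comp}_\Sigma$, unit $\eta_\Sigma$, counit $\varepsilon_\Sigma$, inducing the monad $\mathrm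 M_\Sigma=\mathrm{Term}_\Sigma\mathrm{Cptd}_\Sigma$ with unit $\eta_\Sigma$ and multiplication $\mu_\Sigma$. All of these commute strictly with truncation, and truncations satisfy the cocycle conditions ($\mathrm{tr}_\gamma\mathrm{tr}_\beta=\mathrm{tr}_\gamma$ for $\gamma\le\beta\le\alpha$, and $\mathrm{tr}_\alpha=\mathrm{id}$). An extra subscript $j$ denotes evaluation of a presheaf at the sort $j$. Given the data for all ordinals below $\alpha$: (1) A signature $\Sigma$ of dimension $\alpha$ is a compatible family of signatures $\Sigma_\beta$ ($\beta<\alpha$, $(\Sigma_\beta)_\gamma=\Sigma_\gamma$) and, for each sort $i$ with $\dim i=\alpha$, a set $\Sigma_i$ of function symbols; each $f\in\Sigma_i$ has an arity $B_f$, a presheaf on $\mathcal I_\alpha$, and for each non-identity $\delta:j\to i$, with $\beta=\dim j$, a boundary term $t_{f,\delta}\in\mathrm M_{\Sigma_\beta,j}(\mathrm{tr}_\beta B_f)$, such that $(\delta')^*t_{f,\delta}=t_{f,\delta\delta'}$ for every $\delta':k\to j$. (2) A $\Sigma$-computad $C$ is a compatible family of $\Sigma_\beta$-computads $C_\beta$ ($\beta<\alpha$) and, for each sort $i$ with $\dim i=\alpha$, a set $V_i^C$ of generators with gluing functions $\phi^C_\delta:V_i^C\to\mathrm{Term}_{\Sigma_\beta,j}(C_\beta)$ for non-identity $\delta:j\to i$, $\beta=\dim j$, such that $(\delta')^*\phi^C_\delta=\phi^C_{\delta\delta'}$. (3) For $\dim j=\beta<\alpha$, $\mathrm{Term}_{\Sigma,j}(C)=\mathrm{Term}_{\Sigma_\beta,j}(C_\beta)$.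 For $\dim i=\alpha$, the set $\mathrm{Term}_{\Sigma,i}(C)$ is inductively generated by terms $\mathrm{var}\,v$ for $v\in V_i^C$ and $f[\tau]$ for $f\in\Sigma_i$ and $\tau:\mathrm{Cptd}_\Sigma B_f\to C$ a morphism of computads. For non-identity $\delta:j\to i$, $\beta=\dim j$: $\delta^*(\mathrm{var}\,v)=\phi^C_\delta(v)$ and $\delta^*(f[\tau])=\mathrm{Term}_{\Sigma_\beta,j}(\tau_\beta)(t_{f,\delta})$. (4) A morphism $\sigma:C\to D$ is a compatible family of morphisms $\sigma_\beta:C_\beta\to D_\beta$ ($\beta<\alpha$) and functions $\sigma_i:V_i^C\to\mathrm{Term}_{\Sigma,i}(D)$ for $\dim i=\alpha$ with $\delta^*\sigma_i=\mathrm{Term}_{\Sigma_\beta,j}(\sigma_\beta)\circ\phi^C_\delta$ for non-identity $\delta:j\to i$, $\beta=\dim j$. In dimension $\alpha$, $\mathrm{Term}_\Sigma(\sigma)(\mathrm{var}\,v)=\sigma_i(v)$ and $\mathrm{Term}_\Sigma(\sigma)(f[\tau])=f[\sigma\circ\tau]$; in lower dimension $\mathrm{Term}_\Sigma(\sigma)$ is $\mathrm{Term}_{\Sigma_\beta}(\sigma_\beta)$. Composition: $(\tau\sigma)_\beta=\tau_\beta\sigma_\beta$, $(\tau\sigma)_i=\mathrm{Term}_{\Sigma,i}(\tau)\circ\sigma_i$; identities are given by $\mathrm{id}_{C_\beta}$ and $\mathrm{var}$. (5) $\mathrm{Cptd}_\Sigma X$ consists of $\mathrm{Cptd}_{\Sigma_\beta}\mathrm{tr}_\beta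 X$ ($\beta<\alpha$), generators $X_i$ ($\dim i=\alpha$) and gluing functions $\phi_\delta=\eta_{\Sigma_\beta,\mathrm{tr}_\beta X,j}\circ\delta^*:X_i\to\mathrm M_{\Sigma_\beta,j}(\mathrm{tr}_\beta X)$; on morphisms $(\mathrm{Cptd}_\Sigma\sigma)_i=\mathrm{var}\circ\sigma_i$. (6) $\eta_\Sigma(x)=\mathrm{var}\,x$ for $x$ of sort of dimension $\alpha$ (and $\eta_{\Sigma_\beta}$ below); $\varepsilon_{\Sigma,C}:\mathrm{Cptd}_\Sigma\mathrm{Term}_\Sigma C\to C$ consists of the $\varepsilon_{\Sigma_\beta,C_\beta}$ and the identity functions of $\mathrm{Term}_{\Sigma,i}(C)$. (Items (3),(4) are a valid inductive-recursive definition.) For a sort $i$ of dimension $\beta<\alpha$, the notations $\Sigma_i,V_i^C,\phi^C_\delta,\sigma_i$ refer to $\Sigma_\beta,C_\beta,\sigma_\beta$. **Algebras.** A $\Sigma$-algebra $\mathbb X=(X,u^{\mathbb X})$ is an (Eilenberg–Moore) algebra for the monad $(\mathrm M_\Sigma,\eta_\Sigma,\mu_\Sigma)$ on $[\mathcal I_\alpha^{\mathrm{op}},\mathrm{Set}]$; $\mathrm{Alg}_\Sigma$ is their category. The comparison functor $\mathrm K_\Sigma:\mathrm{Comp}_\Sigma\to\mathrm{Alg}_\Sigma$ sends $C$ to $\mathrm{Term}_\Sigma C$ with action $\mathrm{Term}_\Sigma(\varepsilon_{\Sigma,C})$, and $\sigma$ to $\mathrm{Term}_\Sigma(\sigma)$;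 $\mathrm K_\Sigma C$ is the free algebra on the computad $C$. **Cofibrancy.** For a sort $i\in\mathcal I_\alpha$ put $\mathbb D^i_\Sigma=\mathrm{Cptd}_\Sigma(\mathcal I_\alpha(-,i))$ and $\partial\mathbb D^i_\Sigma=\mathrm{Cptd}_\Sigma(\operatorname{colim}_{\delta:j\to i}\mathcal I_\alpha(-,j))$, the colimit over all non-identity $\delta:j\to i$ (equivalently, of the sub-presheaf of $\mathcal I_\alpha(-,i)$ omitting $\mathrm{id}_i$). The boundary inclusion $\iota_{\Sigma,i}:\partial\mathbb D^i_\Sigma\to\mathbb D^i_\Sigma$ is induced by the presheaf morphism with components $\delta\circ-$. The set $\{\mathrm K_\Sigma\iota_{\Sigma,i}: i\in\mathcal I_\alpha\}$ cofibrantly generates a weak factorisation system on $\mathrm{Alg}_\Sigma$: trivial fibrations are the morphisms with the right lifting property against all $\mathrm K_\Sigma\iota_{\Sigma,i}$, and cofibrations are the morphisms with the left lifting property against all trivial fibrations. An algebra $\mathbb X$ is cofibrant if the unique morphism from the initial algebra to $\mathbb X$ is a cofibration. *)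

theory Defs
  imports Main "HOL-Library.FuncSet"
begin

section \<open>Direct categories and presheaves\<close>

record ('i, 'm, 'o) direct_cat =
  Obj :: "'i set"
  Arr :: "'m set"
  Src :: "'m \<Rightarrow> 'i"
  Tgt :: "'m \<Rightarrow> 'i"
  Ident :: "'i \<Rightarrow> 'm"
  Comp :: "'m \<Rightarrow> 'm \<Rightarrow> 'm"
  Dim :: "'i \<Rightarrow> 'o"

definition nonid :: "('i, 'm, 'o) direct_cat \<Rightarrow> 'm set" where
  "nonid I = Arr I - Ident I ` Obj I"

text \<open>
  \<open>Comp I \<delta> \<delta>'\<close> is the composite \<open>\<delta> \<circ> \<delta>'\<close>. Ordinals are the elements of an arbitrary
  well-ordered type.
\<close>

locale direct_category =
  fixes I :: "('i, 'm, 'o::wellorder) direct_cat"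
  assumes Src_Obj: "\<delta> \<in> Arr I \<Longrightarrow> Src I \<delta> \<in> Obj I"
    and Tgt_Obj: "\<delta> \<in> Arr I \<Longrightarrow> Tgt I \<delta> \<in> Obj I"
    and Ident_Arr: "i \<in> Obj I \<Longrightarrow> Ident I i \<in> Arr I"
    and Src_Ident: "i \<in> Obj I \<Longrightarrow> Src I (Ident I i) = i"
    and Tgt_Ident: "i \<in> Obj I \<Longrightarrow> Tgt I (Ident I i) = i"
    and Comp_Arr: "\<lbrakk>\<delta> \<in> Arr I; \<delta>' \<in> Arr I; Src I \<delta> = Tgt I \<delta>'\<rbrakk> \<Longrightarrow> Comp I \<delta> \<delta>' \<in> Arr I"
    and Src_Comp: "\<lbrakk>\<delta> \<in> Arr I; \<delta>' \<in> Arr I; Src I \<delta> = Tgt I \<delta>'\<rbrakk> \<Longrightarrow> Src I (Comp I \<delta> \<delta>') = Src I \<delta>'"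
    and Tgt_Comp: "\<lbrakk>\<delta> \<in> Arr I; \<delta>' \<in> Arr I; Src I \<delta> = Tgt I \<delta>'\<rbrakk> \<Longrightarrow> Tgt I (Comp I \<delta> \<delta>') = Tgt I \<delta>"
    and Comp_Ident_left: "\<delta> \<in> Arr I \<Longrightarrow> Comp I (Ident I (Tgt I \<delta>)) \<delta> = \<delta>"
    and Comp_Ident_right: "\<delta> \<in> Arr I \<Longrightarrow> Comp I \<delta> (Ident I (Src I \<delta>)) = \<delta>"
    and Comp_assoc: "\<lbrakk>\<delta> \<in> Arr I; \<delta>' \<in> Arr I; \<delta>'' \<in> Arr I; Src I \<delta> = Tgt I \<delta>'; Src I \<delta>' = Tgt I \<delta>''\<rbrakk>
      \<Longrightarrow> Comp I (Comp I \<delta> \<delta>') \<delta>'' = Comp I \<delta> (Comp I \<delta>' \<delta>'')"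
    and Dim_less: "\<delta> \<in> nonid I \<Longrightarrow> Dim I (Src I \<delta>) < Dim I (Tgt I \<delta>)"

definition sorts :: "('i, 'm, 'o::wellorder) direct_cat \<Rightarrow> 'o \<Rightarrow> 'i set" where
  "sorts I \<alpha> = {i \<in> Obj I. Dim I i \<le> \<alpha>}"

text \<open>
  As \<open>sorts I \<alpha>\<close> is a sieve, a presheaf on the full subcategory of sorts of dimension at
  most \<open>\<alpha>\<close> is the same thing as a presheaf on \<open>I\<close> that is empty at all other sorts. The same
  convention is used below for signatures (no function symbols) and computads (no generators)
  of dimension \<open>\<alpha>\<close>, so that truncation discards what lives above the given dimension.
  Families of functions are extensional, i.e. \<open>undefined\<close> outside their domain.
\<close>

record ('i, 'm, 'x) presheaf =
  Car :: "'i \<Rightarrow> 'x set"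
  Act :: "'m \<Rightarrow> 'x \<Rightarrow> 'x"

definition is_presheaf ::
    "('i, 'm, 'o::wellorder) direct_cat \<Rightarrow> 'o \<Rightarrow> ('i, 'm, 'x, 'r) presheaf_scheme \<Rightarrow> bool" where
  "is_presheaf I \<alpha> X \<longleftrightarrow>
     (\<forall>i. i \<notin> sorts I \<alpha> \<longrightarrow> Car X i = {}) \<and>
     (\<forall>\<delta>\<in>Arr I. \<forall>x\<in>Car X (Tgt I \<delta>). Act X \<delta> x \<in> Car X (Src I \<delta>)) \<and>
     (\<forall>i\<in>Obj I. \<forall>x\<in>Car X i. Act X (Ident I i) x = x) \<and>
     (\<forall>\<delta>\<in>Arr I. \<forall>\<delta>'\<in>Arr I. Src I \<delta> = Tgt I \<delta>' \<longrightarrow>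
        (\<forall>x\<in>Car X (Tgt I \<delta>). Act X (Comp I \<delta> \<delta>') x = Act X \<delta>' (Act X \<delta> x)))"

definition presheaf_mor :: "('i, 'm, 'o::wellorder) direct_cat \<Rightarrow> ('i, 'm, 'x, 'r) presheaf_scheme \<Rightarrow>
    ('i, 'm, 'y, 's) presheaf_scheme \<Rightarrow> ('i \<Rightarrow> 'x \<Rightarrow> 'y) \<Rightarrow> bool" where
  "presheaf_mor I X Y h \<longleftrightarrow>
     (\<forall>i. h i \<in> Car X i \<rightarrow>\<^sub>E Car Y i) \<and>
     (\<forall>\<delta>\<in>Arr I. \<forall>x\<in>Car X (Tgt I \<delta>). h (Src I \<delta>) (Act X \<delta> x) = Act Y \<delta> (h (Tgt I \<delta>) x))"

definition restr :: "('i \<Rightarrow> 'x set) \<Rightarrow> ('i \<Rightarrow> 'x \<Rightarrow> 'y) \<Rightarrow> 'i \<Rightarrow> 'x \<Rightarrow> 'y" where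
  "restr A h = (\<lambda>i. restrict (h i) (A i))"

definition tr_presheaf ::
    "('i, 'm, 'o::wellorder) direct_cat \<Rightarrow> 'o \<Rightarrow> ('i, 'm, 'x) presheaf \<Rightarrow> ('i, 'm, 'x) presheaf" where
  "tr_presheaf I \<beta> X = X\<lparr>Car := (\<lambda>i. if i \<in> sorts I \<beta> then Car X i else {})\<rparr>"


section \<open>Signatures, computads and terms\<close>

text \<open>
  A morphism of computads is determined by its components on generators, so the simultaneous
  transfinite recursion can be unfolded: raw terms form an ordinary datatype, on which
  \<open>Term(\<sigma>)\<close> (\<open>subst\<close>) and the action of face maps (\<open>tact\<close>) are plain functions, and the
  dependent families are carved out by predicates. In \<open>Fun i f \<tau>\<close>, the family \<open>\<tau>\<close> gives the
  components of a morphism into the computad under consideration out of the free computad on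
  the arity of \<open>f\<close>.
\<close>

datatype ('i, 'f, 'b, 'v) trm =
    Var 'i 'v
  | Fun 'i 'f "'i \<Rightarrow> 'b \<Rightarrow> ('i, 'f, 'b, 'v) trm"

text \<open>
  \<open>Arity \<Sigma> i f\<close> is the arity of \<open>f \<in> Sym \<Sigma> i\<close>, and \<open>Bdry \<Sigma> \<delta> f\<close> is the boundary
  term of \<open>f \<in> Sym \<Sigma> (Tgt I \<delta>)\<close> along \<open>\<delta>\<close>. Similarly \<open>Glue C \<delta>\<close> is the gluing function on
  \<open>Gen C (Tgt I \<delta>)\<close>. Both are meaningful for non-identity \<open>\<delta>\<close> only.
\<close>

record ('i, 'm, 'f, 'b) sig =
  Sym :: "'i \<Rightarrow> 'f set"
  Arity :: "'i \<Rightarrow> 'f \<Rightarrow> ('i, 'm, 'b) presheaf"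
  Bdry :: "'m \<Rightarrow> 'f \<Rightarrow> ('i, 'f, 'b, 'b) trm"

record ('i, 'm, 'f, 'b, 'v) cptd =
  Gen :: "'i \<Rightarrow> 'v set"
  Glue :: "'m \<Rightarrow> 'v \<Rightarrow> ('i, 'f, 'b, 'v) trm"

primrec subst :: "('i, 'm, 'f, 'b) sig \<Rightarrow> ('i \<Rightarrow> 'v \<Rightarrow> ('i, 'f, 'b, 'w) trm) \<Rightarrow>
    ('i, 'f, 'b, 'v) trm \<Rightarrow> ('i, 'f, 'b, 'w) trm" where
  "subst \<Sigma> \<sigma> (Var i v) = \<sigma> i v"
| "subst \<Sigma> \<sigma> (Fun i f \<tau>) = Fun i f (restr (Car (Arity \<Sigma> i f)) (\<lambda>j b. subst \<Sigma> \<sigma> (\<tau> j b)))"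

definition tact :: "('i, 'm, 'o) direct_cat \<Rightarrow> ('i, 'm, 'f, 'b) sig \<Rightarrow> ('i, 'm, 'f, 'b, 'v) cptd \<Rightarrow>
    'm \<Rightarrow> ('i, 'f, 'b, 'v) trm \<Rightarrow> ('i, 'f, 'b, 'v) trm" where
  "tact I \<Sigma> C \<delta> t =
     (if \<delta> \<in> nonid I then
        (case t of Var i v \<Rightarrow> Glue C \<delta> v | Fun i f \<tau> \<Rightarrow> subst \<Sigma> \<tau> (Bdry \<Sigma> \<delta> f))
      else t)"

definition Cptd :: "('i, 'm, 'o) direct_cat \<Rightarrow> ('i, 'm, 'x, 'r) presheaf_scheme \<Rightarrow>
    ('i, 'm, 'f, 'b, 'x) cptd" where
  "Cptd I X = \<lparr>Gen = Car X, Glue = (\<lambda>\<delta> x. Var (Src I \<delta>) (Act X \<delta> x))\<rparr>"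

text \<open>
  \<open>mor_into I \<Sigma> T C D \<sigma>\<close> says that \<open>\<sigma>\<close> is a morphism from \<open>C\<close> to \<open>D\<close>, where \<open>T\<close> stands for
  the terms of \<open>D\<close>; it is abstracted so that terms and morphisms can be generated together.
\<close>

definition mor_into :: "('i, 'm, 'o) direct_cat \<Rightarrow> ('i, 'm, 'f, 'b) sig \<Rightarrow>
    ('i \<Rightarrow> ('i, 'f, 'b, 'w) trm \<Rightarrow> bool) \<Rightarrow> ('i, 'm, 'f, 'b, 'v) cptd \<Rightarrow> ('i, 'm, 'f, 'b, 'w) cptd \<Rightarrow>
    ('i \<Rightarrow> 'v \<Rightarrow> ('i, 'f, 'b, 'w) trm) \<Rightarrow> bool" where
  "mor_into I \<Sigma> T C D \<sigma> \<longleftrightarrow>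
     (\<forall>i. \<sigma> i \<in> Gen C i \<rightarrow>\<^sub>E {t. T i t}) \<and>
     (\<forall>\<delta>\<in>nonid I. \<forall>v\<in>Gen C (Tgt I \<delta>).
        tact I \<Sigma> D \<delta> (\<sigma> (Tgt I \<delta>) v) = subst \<Sigma> \<sigma> (Glue C \<delta> v))"

lemma mor_into_mono [mono]:
  assumes "\<And>i t. T i t \<longrightarrow> T' i t"
  shows "mor_into I \<Sigma> T C D \<sigma> \<longrightarrow> mor_into I \<Sigma> T' C D \<sigma>"
  using assms unfolding mor_into_def by (fastforce simp: PiE_iff)

inductive is_term :: "('i, 'm, 'o) direct_cat \<Rightarrow> ('i, 'm, 'f, 'b) sig \<Rightarrow> ('i, 'm, 'f, 'b, 'v) cptd \<Rightarrow>
    'i \<Rightarrow> ('i, 'f, 'b, 'v) trm \<Rightarrow> bool"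
  for I \<Sigma> C where
  Var: "v \<in> Gen C i \<Longrightarrow> is_term I \<Sigma> C i (Var i v)"
| Fun: "\<lbrakk>f \<in> Sym \<Sigma> i; mor_into I \<Sigma> (is_term I \<Sigma> C) (Cptd I (Arity \<Sigma> i f)) C \<tau>\<rbrakk>
    \<Longrightarrow> is_term I \<Sigma> C i (Fun i f \<tau>)"

definition cptd_mor :: "('i, 'm, 'o) direct_cat \<Rightarrow> ('i, 'm, 'f, 'b) sig \<Rightarrow> ('i, 'm, 'f, 'b, 'v) cptd \<Rightarrow>
    ('i, 'm, 'f, 'b, 'w) cptd \<Rightarrow> ('i \<Rightarrow> 'v \<Rightarrow> ('i, 'f, 'b, 'w) trm) \<Rightarrow> bool" where
  "cptd_mor I \<Sigma> C D \<sigma> \<longleftrightarrow> mor_into I \<Sigma> (is_term I \<Sigma> D) C D \<sigma>"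

definition Term :: "('i, 'm, 'o) direct_cat \<Rightarrow> ('i, 'm, 'f, 'b) sig \<Rightarrow> ('i, 'm, 'f, 'b, 'v) cptd \<Rightarrow>
    ('i, 'm, ('i, 'f, 'b, 'v) trm) presheaf" where
  "Term I \<Sigma> C = \<lparr>Car = (\<lambda>i. {t. is_term I \<Sigma> C i t}), Act = tact I \<Sigma> C\<rparr>"

definition Term_map :: "('i, 'm, 'o) direct_cat \<Rightarrow> ('i, 'm, 'f, 'b) sig \<Rightarrow> ('i, 'm, 'f, 'b, 'v) cptd \<Rightarrow>
    ('i \<Rightarrow> 'v \<Rightarrow> ('i, 'f, 'b, 'w) trm) \<Rightarrow> 'i \<Rightarrow> ('i, 'f, 'b, 'v) trm \<Rightarrow> ('i, 'f, 'b, 'w) trm" where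
  "Term_map I \<Sigma> C \<sigma> = restr (Car (Term I \<Sigma> C)) (\<lambda>i. subst \<Sigma> \<sigma>)"

definition Cptd_map :: "('i, 'm, 'x, 'r) presheaf_scheme \<Rightarrow> ('i \<Rightarrow> 'x \<Rightarrow> 'y) \<Rightarrow>
    'i \<Rightarrow> 'x \<Rightarrow> ('i, 'f, 'b, 'y) trm" where
  "Cptd_map X h = restr (Car X) (\<lambda>i x. Var i (h i x))"

definition tr_sig :: "('i, 'm, 'o::wellorder) direct_cat \<Rightarrow> 'o \<Rightarrow> ('i, 'm, 'f, 'b) sig \<Rightarrow>
    ('i, 'm, 'f, 'b) sig" where
  "tr_sig I \<beta> \<Sigma> = \<Sigma>\<lparr>Sym := (\<lambda>i. if i \<in> sorts I \<beta> then Sym \<Sigma> i else {})\<rparr>"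

definition tr_cptd :: "('i, 'm, 'o::wellorder) direct_cat \<Rightarrow> 'o \<Rightarrow> ('i, 'm, 'f, 'b, 'v) cptd \<Rightarrow>
    ('i, 'm, 'f, 'b, 'v) cptd" where
  "tr_cptd I \<beta> C = C\<lparr>Gen := (\<lambda>i. if i \<in> sorts I \<beta> then Gen C i else {})\<rparr>"

definition M :: "('i, 'm, 'o) direct_cat \<Rightarrow> ('i, 'm, 'f, 'b) sig \<Rightarrow> ('i, 'm, 'x, 'r) presheaf_scheme \<Rightarrow>
    ('i, 'm, ('i, 'f, 'b, 'x) trm) presheaf" where
  "M I \<Sigma> X = Term I \<Sigma> (Cptd I X)"

definition signature :: "('i, 'm, 'o::wellorder) direct_cat \<Rightarrow> 'o \<Rightarrow> ('i, 'm, 'f, 'b) sig \<Rightarrow> bool" where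
  "signature I \<alpha> \<Sigma> \<longleftrightarrow>
     (\<forall>i. i \<notin> sorts I \<alpha> \<longrightarrow> Sym \<Sigma> i = {}) \<and>
     (\<forall>i. \<forall>f\<in>Sym \<Sigma> i. is_presheaf I (Dim I i) (Arity \<Sigma> i f)) \<and>
     (\<forall>\<delta>\<in>nonid I. \<forall>f\<in>Sym \<Sigma> (Tgt I \<delta>).
        let j = Src I \<delta>; \<beta> = Dim I j;
            MB = M I (tr_sig I \<beta> \<Sigma>) (tr_presheaf I \<beta> (Arity \<Sigma> (Tgt I \<delta>) f))
        in Bdry \<Sigma> \<delta> f \<in> Car MB j \<and>
           (\<forall>\<delta>'\<in>Arr I. Tgt I \<delta>' = j \<longrightarrow> Act MB \<delta>' (Bdry \<Sigma> \<delta> f) = Bdry \<Sigma> (Comp I \<delta> \<delta>') f))"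

definition computad :: "('i, 'm, 'o::wellorder) direct_cat \<Rightarrow> 'o \<Rightarrow> ('i, 'm, 'f, 'b) sig \<Rightarrow>
    ('i, 'm, 'f, 'b, 'v) cptd \<Rightarrow> bool" where
  "computad I \<alpha> \<Sigma> C \<longleftrightarrow>
     (\<forall>i. i \<notin> sorts I \<alpha> \<longrightarrow> Gen C i = {}) \<and>
     (\<forall>\<delta>\<in>nonid I. \<forall>v\<in>Gen C (Tgt I \<delta>).
        let j = Src I \<delta>; \<beta> = Dim I j; TC = Term I (tr_sig I \<beta> \<Sigma>) (tr_cptd I \<beta> C)
        in Glue C \<delta> v \<in> Car TC j \<and>
           (\<forall>\<delta>'\<in>Arr I. Tgt I \<delta>' = j \<longrightarrow> Act TC \<delta>' (Glue C \<delta> v) = Glue C (Comp I \<delta> \<delta>') v))"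


section \<open>The monad and its algebras\<close>

definition M_map :: "('i, 'm, 'o) direct_cat \<Rightarrow> ('i, 'm, 'f, 'b) sig \<Rightarrow> ('i, 'm, 'x, 'r) presheaf_scheme \<Rightarrow>
    ('i \<Rightarrow> 'x \<Rightarrow> 'y) \<Rightarrow> 'i \<Rightarrow> ('i, 'f, 'b, 'x) trm \<Rightarrow> ('i, 'f, 'b, 'y) trm" where
  "M_map I \<Sigma> X h = Term_map I \<Sigma> (Cptd I X) (Cptd_map X h)"

definition eta :: "('i, 'm, 'x, 'r) presheaf_scheme \<Rightarrow> 'i \<Rightarrow> 'x \<Rightarrow> ('i, 'f, 'b, 'x) trm" where
  "eta X = restr (Car X) Var"

definition eps :: "('i, 'm, 'o) direct_cat \<Rightarrow> ('i, 'm, 'f, 'b) sig \<Rightarrow> ('i, 'm, 'f, 'b, 'v) cptd \<Rightarrow>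
    'i \<Rightarrow> ('i, 'f, 'b, 'v) trm \<Rightarrow> ('i, 'f, 'b, 'v) trm" where
  "eps I \<Sigma> C = restr (Car (Term I \<Sigma> C)) (\<lambda>i t. t)"

definition mu :: "('i, 'm, 'o) direct_cat \<Rightarrow> ('i, 'm, 'f, 'b) sig \<Rightarrow> ('i, 'm, 'x, 'r) presheaf_scheme \<Rightarrow>
    'i \<Rightarrow> ('i, 'f, 'b, ('i, 'f, 'b, 'x) trm) trm \<Rightarrow> ('i, 'f, 'b, 'x) trm" where
  "mu I \<Sigma> X = Term_map I \<Sigma> (Cptd I (M I \<Sigma> X)) (eps I \<Sigma> (Cptd I X))"

definition pcomp :: "('i, 'm, 'x, 'r) presheaf_scheme \<Rightarrow> ('i \<Rightarrow> 'y \<Rightarrow> 'z) \<Rightarrow> ('i \<Rightarrow> 'x \<Rightarrow> 'y) \<Rightarrow>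
    'i \<Rightarrow> 'x \<Rightarrow> 'z" where
  "pcomp X g h = (\<lambda>i. compose (Car X i) (g i) (h i))"

record ('i, 'm, 'f, 'b, 'x) alg = "('i, 'm, 'x) presheaf" +
  Ev :: "'i \<Rightarrow> ('i, 'f, 'b, 'x) trm \<Rightarrow> 'x"

definition is_alg :: "('i, 'm, 'o::wellorder) direct_cat \<Rightarrow> 'o \<Rightarrow> ('i, 'm, 'f, 'b) sig \<Rightarrow>
    ('i, 'm, 'f, 'b, 'x) alg \<Rightarrow> bool" where
  "is_alg I \<alpha> \<Sigma> X \<longleftrightarrow>
     is_presheaf I \<alpha> X \<and>
     presheaf_mor I (M I \<Sigma> X) X (Ev X) \<and>
     pcomp X (Ev X) (eta X) = restr (Car X) (\<lambda>i x. x) \<and>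
     pcomp (M I \<Sigma> (M I \<Sigma> X)) (Ev X) (M_map I \<Sigma> (M I \<Sigma> X) (Ev X)) =
       pcomp (M I \<Sigma> (M I \<Sigma> X)) (Ev X) (mu I \<Sigma> X)"

definition alg_mor :: "('i, 'm, 'o::wellorder) direct_cat \<Rightarrow> ('i, 'm, 'f, 'b) sig \<Rightarrow>
    ('i, 'm, 'f, 'b, 'x) alg \<Rightarrow> ('i, 'm, 'f, 'b, 'y) alg \<Rightarrow> ('i \<Rightarrow> 'x \<Rightarrow> 'y) \<Rightarrow> bool" where
  "alg_mor I \<Sigma> X Y h \<longleftrightarrow>
     presheaf_mor I X Y h \<and>
     pcomp (M I \<Sigma> X) h (Ev X) = pcomp (M I \<Sigma> X) (Ev Y) (M_map I \<Sigma> X h)"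

definition K :: "('i, 'm, 'o) direct_cat \<Rightarrow> ('i, 'm, 'f, 'b) sig \<Rightarrow> ('i, 'm, 'f, 'b, 'v) cptd \<Rightarrow>
    ('i, 'm, 'f, 'b, ('i, 'f, 'b, 'v) trm) alg" where
  "K I \<Sigma> C = \<lparr>Car = Car (Term I \<Sigma> C), Act = Act (Term I \<Sigma> C),
     Ev = Term_map I \<Sigma> (Cptd I (Term I \<Sigma> C)) (eps I \<Sigma> C)\<rparr>"

definition K_map :: "('i, 'm, 'o) direct_cat \<Rightarrow> ('i, 'm, 'f, 'b) sig \<Rightarrow> ('i, 'm, 'f, 'b, 'v) cptd \<Rightarrow>
    ('i \<Rightarrow> 'v \<Rightarrow> ('i, 'f, 'b, 'w) trm) \<Rightarrow> 'i \<Rightarrow> ('i, 'f, 'b, 'v) trm \<Rightarrow> ('i, 'f, 'b, 'w) trm" where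
  "K_map I \<Sigma> C \<sigma> = Term_map I \<Sigma> C \<sigma>"


section \<open>Cofibrancy\<close>

definition rep :: "('i, 'm, 'o) direct_cat \<Rightarrow> 'i \<Rightarrow> ('i, 'm, 'm) presheaf" where
  "rep I i = \<lparr>Car = (\<lambda>j. {\<delta> \<in> Arr I. Src I \<delta> = j \<and> Tgt I \<delta> = i}), Act = (\<lambda>\<delta>' \<delta>. Comp I \<delta> \<delta>')\<rparr>"

text \<open>
  The colimit of the \<open>rep I (Src I \<delta>)\<close> over the non-identity \<open>\<delta>\<close> into \<open>i\<close>, realised as a
  sub-presheaf of \<open>rep I i\<close>; its universal property is lemma \<open>bd_rep_colimit\<close> below.
\<close>

definition bd_rep :: "('i, 'm, 'o) direct_cat \<Rightarrow> 'i \<Rightarrow> ('i, 'm, 'm) presheaf" where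
  "bd_rep I i = \<lparr>Car = (\<lambda>j. {\<delta> \<in> nonid I. Src I \<delta> = j \<and> Tgt I \<delta> = i}), Act = (\<lambda>\<delta>' \<delta>. Comp I \<delta> \<delta>')\<rparr>"

definition disc :: "('i, 'm, 'o) direct_cat \<Rightarrow> 'i \<Rightarrow> ('i, 'm, 'f, 'b, 'm) cptd" where
  "disc I i = Cptd I (rep I i)"

definition bd_disc :: "('i, 'm, 'o) direct_cat \<Rightarrow> 'i \<Rightarrow> ('i, 'm, 'f, 'b, 'm) cptd" where
  "bd_disc I i = Cptd I (bd_rep I i)"

definition iota :: "('i, 'm, 'o) direct_cat \<Rightarrow> 'i \<Rightarrow> 'i \<Rightarrow> 'm \<Rightarrow> ('i, 'f, 'b, 'm) trm" where
  "iota I i = Cptd_map (bd_rep I i) (restr (Car (bd_rep I i)) (\<lambda>j \<delta>. \<delta>))"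

definition lifts :: "('i, 'm, 'o::wellorder) direct_cat \<Rightarrow> ('i, 'm, 'f, 'b) sig \<Rightarrow>
    ('i, 'm, 'f, 'b, 'u) alg \<Rightarrow> ('i, 'm, 'f, 'b, 'w) alg \<Rightarrow> ('i \<Rightarrow> 'u \<Rightarrow> 'w) \<Rightarrow>
    ('i, 'm, 'f, 'b, 'y) alg \<Rightarrow> ('i, 'm, 'f, 'b, 'z) alg \<Rightarrow> ('i \<Rightarrow> 'y \<Rightarrow> 'z) \<Rightarrow> bool" where
  "lifts I \<Sigma> A B k Y Z p \<longleftrightarrow>
     (\<forall>a b. alg_mor I \<Sigma> A Y a \<and> alg_mor I \<Sigma> B Z b \<and> pcomp A p a = pcomp A b k \<longrightarrow>
        (\<exists>l. alg_mor I \<Sigma> B Y l \<and> pcomp A l k = a \<and> pcomp B p l = b))"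

definition trivial_fibration :: "('i, 'm, 'o::wellorder) direct_cat \<Rightarrow> 'o \<Rightarrow> ('i, 'm, 'f, 'b) sig \<Rightarrow>
    ('i, 'm, 'f, 'b, 'y) alg \<Rightarrow> ('i, 'm, 'f, 'b, 'z) alg \<Rightarrow> ('i \<Rightarrow> 'y \<Rightarrow> 'z) \<Rightarrow> bool" where
  "trivial_fibration I \<alpha> \<Sigma> Y Z p \<longleftrightarrow>
     is_alg I \<alpha> \<Sigma> Y \<and> is_alg I \<alpha> \<Sigma> Z \<and> alg_mor I \<Sigma> Y Z p \<and>
     (\<forall>i\<in>sorts I \<alpha>. lifts I \<Sigma> (K I \<Sigma> (bd_disc I i)) (K I \<Sigma> (disc I i))
        (K_map I \<Sigma> (bd_disc I i) (iota I i)) Y Z p)"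

text \<open>
  Quantification over all trivial fibrations ranges over algebras with elements in arbitrary
  types; the types of the elements of source and target are therefore parameters.
\<close>

definition cofibration :: "'y itself \<Rightarrow> 'z itself \<Rightarrow>
    ('i, 'm, 'o::wellorder) direct_cat \<Rightarrow> 'o \<Rightarrow> ('i, 'm, 'f, 'b) sig \<Rightarrow>
    ('i, 'm, 'f, 'b, 'u) alg \<Rightarrow> ('i, 'm, 'f, 'b, 'w) alg \<Rightarrow> ('i \<Rightarrow> 'u \<Rightarrow> 'w) \<Rightarrow> bool" where
  "cofibration _ _ I \<alpha> \<Sigma> A B k \<longleftrightarrow>
     is_alg I \<alpha> \<Sigma> A \<and> is_alg I \<alpha> \<Sigma> B \<and> alg_mor I \<Sigma> A B k \<and>
     (\<forall>(Y :: ('i, 'm, 'f, 'b, 'y) alg) (Z :: ('i, 'm, 'f, 'b, 'z) alg) p.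
        trivial_fibration I \<alpha> \<Sigma> Y Z p \<longrightarrow> lifts I \<Sigma> A B k Y Z p)"

text \<open>
  The initial algebra is the free one on the empty presheaf; lemma \<open>initial_alg_ex1\<close> below
  shows that it is initial among algebras with elements in any type.
\<close>

definition empty_presheaf :: "('i, 'm, unit) presheaf" where
  "empty_presheaf = \<lparr>Car = (\<lambda>i. {}), Act = (\<lambda>\<delta> x. x)\<rparr>"

definition initial_alg :: "('i, 'm, 'o) direct_cat \<Rightarrow> ('i, 'm, 'f, 'b) sig \<Rightarrow>
    ('i, 'm, 'f, 'b, ('i, 'f, 'b, unit) trm) alg" where
  "initial_alg I \<Sigma> = K I \<Sigma> (Cptd I empty_presheaf)"

definition cofibrant :: "'y itself \<Rightarrow> 'z itself \<Rightarrow>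
    ('i, 'm, 'o::wellorder) direct_cat \<Rightarrow> 'o \<Rightarrow> ('i, 'm, 'f, 'b) sig \<Rightarrow>
    ('i, 'm, 'f, 'b, 'x) alg \<Rightarrow> bool" where
  "cofibrant TY TZ I \<alpha> \<Sigma> X \<longleftrightarrow>
     cofibration TY TZ I \<alpha> \<Sigma> (initial_alg I \<Sigma>) X (THE h. alg_mor I \<Sigma> (initial_alg I \<Sigma>) X h)"


section \<open>Adequacy of the encoding\<close>

lemma Car_Term [simp]: "Car (Term I \<Sigma> C) i = {t. is_term I \<Sigma> C i t}"
  and Act_Term [simp]: "Act (Term I \<Sigma> C) = tact I \<Sigma> C"
  by (simp_all add: Term_def)

lemma Gen_Cptd [simp]: "Gen (Cptd I X) = Car X"
  and Glue_Cptd [simp]: "Glue (Cptd I X) \<delta> x = Var (Src I \<delta>) (Act X \<delta> x)"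
  by (simp_all add: Cptd_def)

lemma K_simps [simp]:
  "Car (K I \<Sigma> C) i = {t. is_term I \<Sigma> C i t}"
  "Act (K I \<Sigma> C) = tact I \<Sigma> C"
  "Ev (K I \<Sigma> C) = Term_map I \<Sigma> (Cptd I (Term I \<Sigma> C)) (eps I \<Sigma> C)"
  by (simp_all add: K_def)

lemma Cptd_K [simp]: "Cptd I (K I \<Sigma> C) = Cptd I (Term I \<Sigma> C)"
  by (simp add: Cptd_def K_def)

lemma Cptd_map_K [simp]: "Cptd_map (K I \<Sigma> C) h = Cptd_map (Term I \<Sigma> C) h"
  by (simp add: Cptd_map_def K_def)

lemma tr_simps [simp]:
  "Car (tr_presheaf I \<beta> X) i = (if i \<in> sorts I \<beta> then Car X i else {})"
  "Act (tr_presheaf I \<beta> X) = Act X"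
  "Sym (tr_sig I \<beta> \<Sigma>) i = (if i \<in> sorts I \<beta> then Sym \<Sigma> i else {})"
  "Arity (tr_sig I \<beta> \<Sigma>) = Arity \<Sigma>"
  "Bdry (tr_sig I \<beta> \<Sigma>) = Bdry \<Sigma>"
  "Gen (tr_cptd I \<beta> C) i = (if i \<in> sorts I \<beta> then Gen C i else {})"
  "Glue (tr_cptd I \<beta> C) = Glue C"
  by (simp_all add: tr_presheaf_def tr_sig_def tr_cptd_def)

lemma restr_apply: "restr A h i x = (if x \<in> A i then h i x else undefined)"
  by (simp add: restr_def)

lemma presheaf_mor_Car: "presheaf_mor I X Y h \<Longrightarrow> x \<in> Car X i \<Longrightarrow> h i x \<in> Car Y i"
  unfolding presheaf_mor_def by blast

lemma Term_map_apply: "is_term I \<Sigma> C i t \<Longrightarrow> Term_map I \<Sigma> C \<sigma> i t = subst \<Sigma> \<sigma> t"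
  by (simp add: Term_map_def restr_apply)

lemma eps_apply: "is_term I \<Sigma> C i t \<Longrightarrow> eps I \<Sigma> C i t = t"
  by (simp add: eps_def restr_apply)

lemma Cptd_map_apply: "x \<in> Car X i \<Longrightarrow> Cptd_map X h i x = Var i (h i x)"
  by (simp add: Cptd_map_def restr_apply)

lemma restr_eqI: "(\<And>i x. x \<in> A i \<Longrightarrow> h i x = h' i x) \<Longrightarrow> restr A h = restr A h'"
  by (auto simp: restr_def fun_eq_iff)

lemma pcomp_apply: "pcomp X g h i x = (if x \<in> Car X i then g i (h i x) else undefined)"
  by (simp add: pcomp_def compose_def)

lemma pcomp_eq_iff:
  "pcomp X g h = pcomp X g' h' \<longleftrightarrow> (\<forall>i. \<forall>x\<in>Car X i. g i (h i x) = g' i (h' i x))"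
proof
  assume eq: "pcomp X g h = pcomp X g' h'"
  show "\<forall>i. \<forall>x\<in>Car X i. g i (h i x) = g' i (h' i x)"
  proof (intro allI ballI)
    fix i x assume "x \<in> Car X i"
    then show "g i (h i x) = g' i (h' i x)"
      using fun_cong[OF fun_cong[OF eq, of i], of x] by (simp add: pcomp_apply)
  qed
qed (simp add: fun_eq_iff pcomp_apply)

lemma tr_sig_tr_sig: "\<gamma> \<le> \<beta> \<Longrightarrow> tr_sig I \<gamma> (tr_sig I \<beta> \<Sigma>) = tr_sig I \<gamma> \<Sigma>"
  by (auto simp: tr_sig_def sorts_def fun_eq_iff intro!: sig.equality)

lemma tr_cptd_tr_cptd: "\<gamma> \<le> \<beta> \<Longrightarrow> tr_cptd I \<gamma> (tr_cptd I \<beta> C) = tr_cptd I \<gamma> C"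
  by (auto simp: tr_cptd_def sorts_def fun_eq_iff intro!: cptd.equality)

lemma tr_presheaf_tr_presheaf: "\<gamma> \<le> \<beta> \<Longrightarrow> tr_presheaf I \<gamma> (tr_presheaf I \<beta> X) = tr_presheaf I \<gamma> X"
  by (auto simp: tr_presheaf_def sorts_def fun_eq_iff intro!: presheaf.equality)

lemma tr_sig_id: "signature I \<alpha> \<Sigma> \<Longrightarrow> tr_sig I \<alpha> \<Sigma> = \<Sigma>"
  by (auto simp: tr_sig_def signature_def fun_eq_iff intro!: sig.equality)

lemma tr_cptd_id: "computad I \<alpha> \<Sigma> C \<Longrightarrow> tr_cptd I \<alpha> C = C"
  by (auto simp: tr_cptd_def computad_def fun_eq_iff intro!: cptd.equality)

lemma Cptd_tr_presheaf: "Cptd I (tr_presheaf I \<beta> X) = tr_cptd I \<beta> (Cptd I X)"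
  by (simp add: Cptd_def tr_presheaf_def tr_cptd_def fun_eq_iff)

lemma subst_tr_sig [simp]: "subst (tr_sig I \<beta> \<Sigma>) \<sigma> t = subst \<Sigma> \<sigma> t"
  by (induction t) (auto intro!: restr_eqI)

lemma tact_tr [simp]: "tact I (tr_sig I \<beta> \<Sigma>) (tr_cptd I \<beta> C) \<delta> t = tact I \<Sigma> C \<delta> t"
  by (simp add: tact_def split: trm.split)

lemma tact_nonid:
  "\<delta> \<in> nonid I \<Longrightarrow> tact I \<Sigma> C \<delta> (Var i v) = Glue C \<delta> v"
  "\<delta> \<in> nonid I \<Longrightarrow> tact I \<Sigma> C \<delta> (Fun i f \<tau>) = subst \<Sigma> \<tau> (Bdry \<Sigma> \<delta> f)"
  by (simp_all add: tact_def)

lemma is_term_induct [consumes 1, case_names Var Fun]: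
  assumes "is_term I \<Sigma> C i t"
    and "\<And>v i. v \<in> Gen C i \<Longrightarrow> P i (Var i v)"
    and "\<And>f i \<tau>. \<lbrakk>f \<in> Sym \<Sigma> i; cptd_mor I \<Sigma> (Cptd I (Arity \<Sigma> i f)) C \<tau>;
        \<And>j b. b \<in> Car (Arity \<Sigma> i f) j \<Longrightarrow> is_term I \<Sigma> C j (\<tau> j b);
        \<And>j b. b \<in> Car (Arity \<Sigma> i f) j \<Longrightarrow> P j (\<tau> j b);
        \<And>j b. b \<notin> Car (Arity \<Sigma> i f) j \<Longrightarrow> \<tau> j b = undefined\<rbrakk> \<Longrightarrow> P i (Fun i f \<tau>)"
  shows "P i t"
  using assms(1)
proof (induction rule: is_term.induct)
  case (Var v i)
  then show ?case by (rule assms(2))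
next
  case (Fun f i \<tau>)
  have m: "mor_into I \<Sigma> (is_term I \<Sigma> C) (Cptd I (Arity \<Sigma> i f)) C \<tau>"
    by (rule mor_into_mono[THEN mp, OF _ Fun(2)]) simp
  have "\<And>j. \<tau> j \<in> Car (Arity \<Sigma> i f) j \<rightarrow>\<^sub>E {t. is_term I \<Sigma> C j t \<and> P j t}"
    using Fun(2) by (simp add: mor_into_def)
  then show ?case
    using Fun(1) m by (intro assms(3)) (auto simp: cptd_mor_def PiE_iff extensional_def)
qed

lemma is_term_cases:
  "is_term I \<Sigma> C i t \<longleftrightarrow>
     (\<exists>v\<in>Gen C i. t = Var i v) \<or>
     (\<exists>f\<in>Sym \<Sigma> i. \<exists>\<tau>. cptd_mor I \<Sigma> (Cptd I (Arity \<Sigma> i f)) C \<tau> \<and> t = Fun i f \<tau>)"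
  unfolding cptd_mor_def by (subst is_term.simps) auto

lemma cptd_mor_term: "cptd_mor I \<Sigma> C D \<sigma> \<Longrightarrow> v \<in> Gen C i \<Longrightarrow> is_term I \<Sigma> D i (\<sigma> i v)"
  unfolding cptd_mor_def mor_into_def by auto

lemma cptd_mor_undefined: "cptd_mor I \<Sigma> C D \<sigma> \<Longrightarrow> v \<notin> Gen C i \<Longrightarrow> \<sigma> i v = undefined"
  unfolding cptd_mor_def mor_into_def by (auto simp: PiE_iff extensional_def)

lemma cptd_mor_glue: "\<lbrakk>cptd_mor I \<Sigma> C D \<sigma>; \<delta> \<in> nonid I; v \<in> Gen C (Tgt I \<delta>)\<rbrakk>
    \<Longrightarrow> tact I \<Sigma> D \<delta> (\<sigma> (Tgt I \<delta>) v) = subst \<Sigma> \<sigma> (Glue C \<delta> v)"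
  unfolding cptd_mor_def mor_into_def by auto

lemma cptd_morI:
  assumes "\<And>i v. v \<in> Gen C i \<Longrightarrow> is_term I \<Sigma> D i (\<sigma> i v)"
    and "\<And>i v. v \<notin> Gen C i \<Longrightarrow> \<sigma> i v = undefined"
    and "\<And>\<delta> v. \<lbrakk>\<delta> \<in> nonid I; v \<in> Gen C (Tgt I \<delta>)\<rbrakk>
      \<Longrightarrow> tact I \<Sigma> D \<delta> (\<sigma> (Tgt I \<delta>) v) = subst \<Sigma> \<sigma> (Glue C \<delta> v)"
  shows "cptd_mor I \<Sigma> C D \<sigma>"
  using assms unfolding cptd_mor_def mor_into_def by (auto simp: PiE_iff extensional_def)

lemma subst_cong:
  assumes "is_term I \<Sigma> C i t" "\<And>i v. v \<in> Gen C i \<Longrightarrow> \<sigma> i v = \<sigma>' i v"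
  shows "subst \<Sigma> \<sigma> t = subst \<Sigma> \<sigma>' t"
  using assms(1) by (induction rule: is_term_induct) (auto simp: assms(2) intro!: restr_eqI)

lemma subst_subst:
  assumes "is_term I \<Sigma> C i t" "\<And>i v. v \<in> Gen C i \<Longrightarrow> subst \<Sigma> \<rho> (\<sigma> i v) = \<upsilon> i v"
  shows "subst \<Sigma> \<rho> (subst \<Sigma> \<sigma> t) = subst \<Sigma> \<upsilon> t"
  using assms(1)
  by (induction rule: is_term_induct) (auto simp: assms(2) restr_apply intro!: restr_eqI)

lemma subst_ident:
  assumes "is_term I \<Sigma> C i t" "\<And>i v. v \<in> Gen C i \<Longrightarrow> \<sigma> i v = Var i v"
  shows "subst \<Sigma> \<sigma> t = t"
  using assms(1)
  by (induction rule: is_term_induct) (auto simp: assms(2) restr_apply fun_eq_iff)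

context direct_category
begin

lemma nonid_Arr: "\<delta> \<in> nonid I \<Longrightarrow> \<delta> \<in> Arr I"
  by (simp add: nonid_def)

lemma Arr_cases [consumes 1, case_names Ident nonid]:
  assumes "\<delta> \<in> Arr I"
  obtains i where "i \<in> Obj I" "\<delta> = Ident I i" | "\<delta> \<in> nonid I"
  using assms by (auto simp: nonid_def)

lemma Ident_not_nonid: "i \<in> Obj I \<Longrightarrow> Ident I i \<notin> nonid I"
  by (simp add: nonid_def)

lemma Dim_le: "\<delta> \<in> Arr I \<Longrightarrow> Dim I (Src I \<delta>) \<le> Dim I (Tgt I \<delta>)"
  by (erule Arr_cases) (auto simp: Src_Ident Tgt_Ident dest: Dim_less)

lemma Src_sorts: "\<lbrakk>\<delta> \<in> Arr I; Tgt I \<delta> \<in> sorts I \<alpha>\<rbrakk> \<Longrightarrow> Src I \<delta> \<in> sorts I \<alpha>"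
  using Dim_le Src_Obj by (force simp: sorts_def)

lemma Comp_nonid: "\<lbrakk>\<delta> \<in> nonid I; \<delta>' \<in> Arr I; Src I \<delta> = Tgt I \<delta>'\<rbrakk> \<Longrightarrow> Comp I \<delta> \<delta>' \<in> nonid I"
proof -
  assume a: "\<delta> \<in> nonid I" "\<delta>' \<in> Arr I" "Src I \<delta> = Tgt I \<delta>'"
  have "Dim I (Src I (Comp I \<delta> \<delta>')) < Dim I (Tgt I (Comp I \<delta> \<delta>'))"
    using a Dim_less[OF a(1)] Dim_le[OF a(2)] by (simp add: Src_Comp Tgt_Comp nonid_Arr)
  then show ?thesis
    using a by (auto simp: nonid_def Comp_Arr Src_Ident Tgt_Ident)
qed

lemma Comp_nonid': "\<lbrakk>\<delta> \<in> Arr I; \<delta>' \<in> nonid I; Src I \<delta> = Tgt I \<delta>'\<rbrakk> \<Longrightarrow> Comp I \<delta> \<delta>' \<in> nonid I"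
proof -
  assume a: "\<delta> \<in> Arr I" "\<delta>' \<in> nonid I" "Src I \<delta> = Tgt I \<delta>'"
  have "Dim I (Src I (Comp I \<delta> \<delta>')) < Dim I (Tgt I (Comp I \<delta> \<delta>'))"
    using a Dim_less[OF a(2)] Dim_le[OF a(1)] by (simp add: Src_Comp Tgt_Comp nonid_Arr)
  then show ?thesis
    using a by (auto simp: nonid_def Comp_Arr Src_Ident Tgt_Ident)
qed

lemma is_presheaf_rep: "i \<in> sorts I \<alpha> \<Longrightarrow> is_presheaf I \<alpha> (rep I i)"
  by (auto simp: is_presheaf_def rep_def Comp_Arr Src_Comp Tgt_Comp Comp_assoc Src_sorts
      Comp_Ident_right)

lemma is_presheaf_bd_rep: "i \<in> sorts I \<alpha> \<Longrightarrow> is_presheaf I \<alpha> (bd_rep I i)"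
  by (auto simp: is_presheaf_def bd_rep_def Comp_nonid nonid_Arr Src_Comp Tgt_Comp Comp_assoc
      Src_sorts Comp_Ident_right)

lemma bd_rep_colimit:
  assumes "is_presheaf I \<alpha> Y" "i \<in> sorts I \<alpha>"
    and mor: "\<And>\<delta>. \<lbrakk>\<delta> \<in> nonid I; Tgt I \<delta> = i\<rbrakk> \<Longrightarrow> presheaf_mor I (rep I (Src I \<delta>)) Y (g \<delta>)"
    and cocone: "\<And>\<delta> \<delta>' j \<epsilon>. \<lbrakk>\<delta> \<in> nonid I; Tgt I \<delta> = i; \<delta>' \<in> Arr I; Tgt I \<delta>' = Src I \<delta>;
      \<epsilon> \<in> Car (rep I (Src I \<delta>')) j\<rbrakk> \<Longrightarrow> g (Comp I \<delta> \<delta>') j \<epsilon> = g \<delta> j (Comp I \<delta>' \<epsilon>)"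
  shows "\<exists>!h. presheaf_mor I (bd_rep I i) Y h \<and>
    (\<forall>\<delta>\<in>nonid I. Tgt I \<delta> = i \<longrightarrow> (\<forall>j. \<forall>\<epsilon>\<in>Car (rep I (Src I \<delta>)) j. h j (Comp I \<delta> \<epsilon>) = g \<delta> j \<epsilon>))"
proof (rule ex1I)
  define h where "h = restr (Car (bd_rep I i)) (\<lambda>j \<delta>. g \<delta> j (Ident I (Src I \<delta>)))"
  have id: "Ident I j \<in> Car (rep I j) j" if "j \<in> Obj I" for j
    using that by (simp add: rep_def Ident_Arr Src_Ident Tgt_Ident)
  have hh: "h j (Comp I \<delta> \<epsilon>) = g \<delta> j \<epsilon>"
    if "\<delta> \<in> nonid I" "Tgt I \<delta> = i" "\<epsilon> \<in> Car (rep I (Src I \<delta>)) j" for \<delta> j \<epsilon>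
  proof -
    have e: "\<epsilon> \<in> Arr I" "Src I \<epsilon> = j" "Tgt I \<epsilon> = Src I \<delta>" using that by (auto simp: rep_def)
    have "h j (Comp I \<delta> \<epsilon>) = g (Comp I \<delta> \<epsilon>) j (Ident I j)"
      using that e by (simp add: h_def restr_apply bd_rep_def Comp_nonid Src_Comp Tgt_Comp nonid_Arr)
    also have "\<dots> = g \<delta> j (Comp I \<epsilon> (Ident I j))"
      using that e id[of j] Src_Obj[of \<epsilon>] by (intro cocone) auto
    finally show ?thesis using e Comp_Ident_right by auto
  qed
  have nat: "h (Src I \<delta>') (Comp I \<delta> \<delta>') = Act Y \<delta>' (h (Tgt I \<delta>') \<delta>)"
    if d: "\<delta>' \<in> Arr I" "\<delta> \<in> nonid I" "Src I \<delta> = Tgt I \<delta>'" "Tgt I \<delta> = i" for \<delta> \<delta>'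
  proof -
    have "h (Src I \<delta>') (Comp I \<delta> \<delta>') = g \<delta> (Src I \<delta>') \<delta>'"
      using d by (intro hh) (auto simp: rep_def)
    also have "\<dots> = g \<delta> (Src I \<delta>') (Act (rep I (Src I \<delta>)) \<delta>' (Ident I (Src I \<delta>)))"
      using d by (simp add: rep_def Comp_Ident_left)
    also have "\<dots> = Act Y \<delta>' (g \<delta> (Tgt I \<delta>') (Ident I (Src I \<delta>)))"
      using mor[OF d(2,4)] d(1) id[of "Src I \<delta>"] Src_Obj[of \<delta>] d
      by (auto simp: presheaf_mor_def nonid_Arr)
    also have "\<dots> = Act Y \<delta>' (h (Tgt I \<delta>') \<delta>)"
      using d by (simp add: h_def restr_apply bd_rep_def)
    finally show ?thesis .
  qed
  have "h j \<in> Car (bd_rep I i) j \<rightarrow>\<^sub>E Car Y j" for j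
    using mor id Src_Obj nonid_Arr
    by (auto simp: presheaf_mor_def h_def restr_def bd_rep_def PiE_iff)
  then show "presheaf_mor I (bd_rep I i) Y h \<and>
    (\<forall>\<delta>\<in>nonid I. Tgt I \<delta> = i \<longrightarrow> (\<forall>j. \<forall>\<epsilon>\<in>Car (rep I (Src I \<delta>)) j. h j (Comp I \<delta> \<epsilon>) = g \<delta> j \<epsilon>))"
    using nat hh by (auto simp: presheaf_mor_def bd_rep_def)
  fix k assume k: "presheaf_mor I (bd_rep I i) Y k \<and>
    (\<forall>\<delta>\<in>nonid I. Tgt I \<delta> = i \<longrightarrow> (\<forall>j. \<forall>\<epsilon>\<in>Car (rep I (Src I \<delta>)) j. k j (Comp I \<delta> \<epsilon>) = g \<delta> j \<epsilon>))"
  show "k = h"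
  proof (intro ext)
    fix j \<delta>
    show "k j \<delta> = h j \<delta>"
    proof (cases "\<delta> \<in> Car (bd_rep I i) j")
      case True
      then have d: "\<delta> \<in> nonid I" "Tgt I \<delta> = i" "Src I \<delta> = j" by (auto simp: bd_rep_def)
      have "k j (Comp I \<delta> (Ident I j)) = g \<delta> j (Ident I j)"
        using k d id[of j] Src_Obj[of \<delta>] nonid_Arr by auto
      then show ?thesis
        using True d Comp_Ident_right[of \<delta>] by (simp add: h_def restr_apply nonid_Arr)
    next
      case False
      then show ?thesis using k by (auto simp: h_def restr_apply presheaf_mor_def PiE_iff extensional_def)
    qed
  qed
qed

end

locale sorted_signature = direct_category I
  for I :: "('i, 'm, 'o::wellorder) direct_cat" +
  fixes \<alpha> :: 'o and \<Sigma> :: "('i, 'm, 'f, 'b) sig"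
  assumes signature: "signature I \<alpha> \<Sigma>"
begin

lemma Sym_sorts: "f \<in> Sym \<Sigma> i \<Longrightarrow> i \<in> sorts I \<alpha>"
  using signature unfolding signature_def by blast

lemma Arity_presheaf: "f \<in> Sym \<Sigma> i \<Longrightarrow> is_presheaf I (Dim I i) (Arity \<Sigma> i f)"
  using signature unfolding signature_def by blast

lemma Arity_sorts: "\<lbrakk>f \<in> Sym \<Sigma> i; b \<in> Car (Arity \<Sigma> i f) j; i \<in> sorts I \<beta>\<rbrakk> \<Longrightarrow> j \<in> sorts I \<beta>"
  using Arity_presheaf[of f i] by (force simp: is_presheaf_def sorts_def)

text \<open>Passing to a truncation does not change the terms of the remaining sorts.\<close>

lemma is_term_tr:
  "is_term I (tr_sig I \<beta> \<Sigma>) (tr_cptd I \<beta> C) i t \<longleftrightarrow> i \<in> sorts I \<beta> \<and> is_term I \<Sigma> C i t"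
proof
  assume "is_term I (tr_sig I \<beta> \<Sigma>) (tr_cptd I \<beta> C) i t"
  then show "i \<in> sorts I \<beta> \<and> is_term I \<Sigma> C i t"
  proof (induction rule: is_term_induct)
    case (Var v i)
    then show ?case by (auto split: if_splits intro: is_term.Var)
  next
    case (Fun f i \<tau>)
    have "cptd_mor I \<Sigma> (Cptd I (Arity \<Sigma> i f)) C \<tau>"
      using Fun cptd_mor_glue[OF Fun(2)] by (intro cptd_morI) auto
    then show ?case
      using Fun(1) by (auto simp: cptd_mor_def split: if_splits intro: is_term.Fun)
  qed
next
  assume "i \<in> sorts I \<beta> \<and> is_term I \<Sigma> C i t"
  then have "is_term I \<Sigma> C i t" "i \<in> sorts I \<beta>" by auto
  then show "is_term I (tr_sig I \<beta> \<Sigma>) (tr_cptd I \<beta> C) i t"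
  proof (induction rule: is_term_induct)
    case (Var v i)
    then show ?case by (auto intro: is_term.Var)
  next
    case (Fun f i \<tau>)
    have "cptd_mor I (tr_sig I \<beta> \<Sigma>) (Cptd I (Arity \<Sigma> i f)) (tr_cptd I \<beta> C) \<tau>"
      using Fun Arity_sorts cptd_mor_glue[OF Fun(2)] by (intro cptd_morI) auto
    then show ?case
      using Fun(1,6) by (auto simp: cptd_mor_def intro: is_term.Fun)
  qed
qed

lemma signature_tr:
  assumes "\<beta> \<le> \<alpha>"
  shows "signature I \<beta> (tr_sig I \<beta> \<Sigma>)"
proof -
  have "tr_sig I (Dim I (Src I \<delta>)) (tr_sig I \<beta> \<Sigma>) = tr_sig I (Dim I (Src I \<delta>)) \<Sigma>"
    if "\<delta> \<in> nonid I" "Tgt I \<delta> \<in> sorts I \<beta>" for \<delta>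
    using that Src_sorts[of \<delta> \<beta>] by (intro tr_sig_tr_sig) (auto simp: sorts_def nonid_Arr)
  then show ?thesis
    using signature unfolding signature_def Let_def by auto
qed

lemma computad_tr:
  assumes "\<beta> \<le> \<alpha>" "computad I \<alpha> \<Sigma> C"
  shows "computad I \<beta> (tr_sig I \<beta> \<Sigma>) (tr_cptd I \<beta> C)"
proof -
  have "tr_sig I (Dim I (Src I \<delta>)) (tr_sig I \<beta> \<Sigma>) = tr_sig I (Dim I (Src I \<delta>)) \<Sigma>"
    "tr_cptd I (Dim I (Src I \<delta>)) (tr_cptd I \<beta> C) = tr_cptd I (Dim I (Src I \<delta>)) C"
    if "\<delta> \<in> nonid I" "Tgt I \<delta> \<in> sorts I \<beta>" for \<delta>
    using that Src_sorts[of \<delta> \<beta>]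
    by (auto intro!: tr_sig_tr_sig tr_cptd_tr_cptd simp: sorts_def nonid_Arr)
  then show ?thesis
    using assms(2) unfolding computad_def Let_def by auto
qed

lemma Bdry_term:
  assumes "\<delta> \<in> nonid I" "f \<in> Sym \<Sigma> (Tgt I \<delta>)"
  shows "is_term I \<Sigma> (Cptd I (Arity \<Sigma> (Tgt I \<delta>) f)) (Src I \<delta>) (Bdry \<Sigma> \<delta> f)"
  using signature assms unfolding signature_def Let_def
  by (auto simp: M_def Cptd_tr_presheaf is_term_tr)

lemma Bdry_Comp:
  assumes "\<delta> \<in> nonid I" "f \<in> Sym \<Sigma> (Tgt I \<delta>)" "\<delta>' \<in> Arr I" "Tgt I \<delta>' = Src I \<delta>"
  shows "tact I \<Sigma> (Cptd I (Arity \<Sigma> (Tgt I \<delta>) f)) \<delta>' (Bdry \<Sigma> \<delta> f) = Bdry \<Sigma> (Comp I \<delta> \<delta>') f"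
  using signature assms unfolding signature_def Let_def
  by (auto simp: M_def Cptd_tr_presheaf)

lemma Gen_sorts: "computad I \<alpha> \<Sigma> C \<Longrightarrow> v \<in> Gen C i \<Longrightarrow> i \<in> sorts I \<alpha>"
  unfolding computad_def by blast

lemma Glue_term:
  assumes "computad I \<alpha> \<Sigma> C" "\<delta> \<in> nonid I" "v \<in> Gen C (Tgt I \<delta>)"
  shows "is_term I \<Sigma> C (Src I \<delta>) (Glue C \<delta> v)"
  using assms unfolding computad_def Let_def by (auto simp: is_term_tr)

lemma Glue_Comp:
  assumes "computad I \<alpha> \<Sigma> C" "\<delta> \<in> nonid I" "v \<in> Gen C (Tgt I \<delta>)" "\<delta>' \<in> Arr I" "Tgt I \<delta>' = Src I \<delta>"
  shows "tact I \<Sigma> C \<delta>' (Glue C \<delta> v) = Glue C (Comp I \<delta> \<delta>') v"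
  using assms unfolding computad_def Let_def by auto

lemma computadI:
  assumes "\<And>i v. v \<in> Gen C i \<Longrightarrow> i \<in> sorts I \<alpha>"
    and "\<And>\<delta> v. \<lbrakk>\<delta> \<in> nonid I; v \<in> Gen C (Tgt I \<delta>)\<rbrakk> \<Longrightarrow> is_term I \<Sigma> C (Src I \<delta>) (Glue C \<delta> v)"
    and "\<And>\<delta> v \<delta>'. \<lbrakk>\<delta> \<in> nonid I; v \<in> Gen C (Tgt I \<delta>); \<delta>' \<in> Arr I; Tgt I \<delta>' = Src I \<delta>\<rbrakk>
      \<Longrightarrow> tact I \<Sigma> C \<delta>' (Glue C \<delta> v) = Glue C (Comp I \<delta> \<delta>') v"
  shows "computad I \<alpha> \<Sigma> C"
  using assms Src_Obj nonid_Arr unfolding computad_def Let_def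
  by (auto simp: is_term_tr) (auto simp: sorts_def)

lemma term_sorts: "is_term I \<Sigma> C i t \<Longrightarrow> computad I \<alpha> \<Sigma> C \<Longrightarrow> i \<in> sorts I \<alpha>"
  by (auto simp: is_term_cases[of I \<Sigma> C i t] Sym_sorts Gen_sorts)

lemma tact_subst:
  assumes "cptd_mor I \<Sigma> C D \<sigma>" "is_term I \<Sigma> C (Tgt I \<delta>) t"
  shows "tact I \<Sigma> D \<delta> (subst \<Sigma> \<sigma> t) = subst \<Sigma> \<sigma> (tact I \<Sigma> C \<delta> t)"
proof (cases "\<delta> \<in> nonid I")
  case True
  from assms(2) consider v where "v \<in> Gen C (Tgt I \<delta>)" "t = Var (Tgt I \<delta>) v"
    | f \<tau> where "f \<in> Sym \<Sigma> (Tgt I \<delta>)" "t = Fun (Tgt I \<delta>) f \<tau>"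
    by (auto simp: is_term_cases[of I \<Sigma> C _ t])
  then show ?thesis
  proof cases
    case 1
    then show ?thesis using cptd_mor_glue[OF assms(1) True] True by (simp add: tact_nonid)
  next
    case 2
    have "subst \<Sigma> \<sigma> (subst \<Sigma> \<tau> (Bdry \<Sigma> \<delta> f)) =
      subst \<Sigma> (restr (Car (Arity \<Sigma> (Tgt I \<delta>) f)) (\<lambda>j b. subst \<Sigma> \<sigma> (\<tau> j b))) (Bdry \<Sigma> \<delta> f)"
      by (rule subst_subst[OF Bdry_term[OF True 2(1)]]) (simp add: restr_apply)
    then show ?thesis using 2 True by (simp add: tact_nonid)
  qed
qed (simp add: tact_def)

lemma subst_term:
  assumes "is_term I \<Sigma> C i t" "cptd_mor I \<Sigma> C D \<sigma>"
  shows "is_term I \<Sigma> D i (subst \<Sigma> \<sigma> t)"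
  using assms(1)
proof (induction rule: is_term_induct)
  case (Var v i)
  then show ?case using assms(2) by (simp add: cptd_mor_term)
next
  case (Fun f i \<tau>)
  let ?B = "Arity \<Sigma> i f"
  let ?\<tau> = "restr (Car ?B) (\<lambda>j b. subst \<Sigma> \<sigma> (\<tau> j b))"
  have "cptd_mor I \<Sigma> (Cptd I ?B) D ?\<tau>"
  proof (rule cptd_morI)
    fix \<delta> b assume "\<delta> \<in> nonid I" "b \<in> Gen (Cptd I ?B) (Tgt I \<delta>)"
    then have d: "\<delta> \<in> nonid I" "b \<in> Car ?B (Tgt I \<delta>)" by simp_all
    then have b: "Act ?B \<delta> b \<in> Car ?B (Src I \<delta>)"
      using Arity_presheaf[OF Fun(1)] by (simp add: is_presheaf_def nonid_Arr)
    show "tact I \<Sigma> D \<delta> (?\<tau> (Tgt I \<delta>) b) = subst \<Sigma> ?\<tau> (Glue (Cptd I ?B) \<delta> b)"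
      using d b tact_subst[OF assms(2)] Fun(3) cptd_mor_glue[OF Fun(2) d(1)]
      by (simp add: restr_apply)
  qed (use Fun in \<open>auto simp: restr_apply\<close>)
  then show ?case
    using Fun(1) by (auto simp: cptd_mor_def intro: is_term.Fun)
qed

lemma tact_Ident: "i \<in> Obj I \<Longrightarrow> tact I \<Sigma> C (Ident I i) t = t"
  by (simp add: tact_def Ident_not_nonid)

lemma tact_term:
  assumes "computad I \<alpha> \<Sigma> C" "\<delta> \<in> Arr I" "is_term I \<Sigma> C (Tgt I \<delta>) t"
  shows "is_term I \<Sigma> C (Src I \<delta>) (tact I \<Sigma> C \<delta> t)"
  using assms(2)
proof (cases rule: Arr_cases)
  case (Ident i)
  then show ?thesis using assms by (simp add: tact_def Ident_not_nonid Src_Ident Tgt_Ident)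
next
  case nonid
  from assms(3) consider v where "v \<in> Gen C (Tgt I \<delta>)" "t = Var (Tgt I \<delta>) v"
    | f \<tau> where "f \<in> Sym \<Sigma> (Tgt I \<delta>)" "t = Fun (Tgt I \<delta>) f \<tau>"
        "cptd_mor I \<Sigma> (Cptd I (Arity \<Sigma> (Tgt I \<delta>) f)) C \<tau>"
    by (auto simp: is_term_cases[of I \<Sigma> C _ t])
  then show ?thesis
  proof cases
    case 1
    then show ?thesis using Glue_term assms(1) nonid by (simp add: tact_nonid)
  next
    case 2
    then show ?thesis using subst_term[OF Bdry_term[OF nonid 2(1)] 2(3)] nonid
      by (simp add: tact_nonid)
  qed
qed

lemma tact_Comp:
  assumes "computad I \<alpha> \<Sigma> C" "\<delta> \<in> Arr I" "\<delta>' \<in> Arr I" "Src I \<delta> = Tgt I \<delta>'"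
    "is_term I \<Sigma> C (Tgt I \<delta>) t"
  shows "tact I \<Sigma> C (Comp I \<delta> \<delta>') t = tact I \<Sigma> C \<delta>' (tact I \<Sigma> C \<delta> t)"
  using assms(2)
proof (cases rule: Arr_cases)
  case (Ident i)
  then show ?thesis using assms Comp_Ident_left[of \<delta>']
    by (auto simp: tact_Ident Src_Ident)
next
  case nonid
  note c = Comp_nonid[OF nonid assms(3,4)]
  from assms(5) consider v where "v \<in> Gen C (Tgt I \<delta>)" "t = Var (Tgt I \<delta>) v"
    | f \<tau> where "f \<in> Sym \<Sigma> (Tgt I \<delta>)" "t = Fun (Tgt I \<delta>) f \<tau>"
        "cptd_mor I \<Sigma> (Cptd I (Arity \<Sigma> (Tgt I \<delta>) f)) C \<tau>"
    by (auto simp: is_term_cases[of I \<Sigma> C _ t])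
  then show ?thesis
  proof cases
    case 1
    then show ?thesis using Glue_Comp[OF assms(1) nonid 1(1) assms(3)] assms(4) nonid c
      by (simp add: tact_nonid)
  next
    case 2
    have "is_term I \<Sigma> (Cptd I (Arity \<Sigma> (Tgt I \<delta>) f)) (Tgt I \<delta>') (Bdry \<Sigma> \<delta> f)"
      using Bdry_term[OF nonid 2(1)] assms(4) by simp
    from tact_subst[OF 2(3) this] show ?thesis
      using Bdry_Comp[OF nonid 2(1) assms(3)] assms(4) nonid c 2(2) by (simp add: tact_nonid)
  qed
qed

lemma is_presheaf_Term: "computad I \<alpha> \<Sigma> C \<Longrightarrow> is_presheaf I \<alpha> (Term I \<Sigma> C)"
  unfolding is_presheaf_def using term_sorts tact_term tact_Comp tact_Ident by auto

lemma is_presheaf_K: "computad I \<alpha> \<Sigma> C \<Longrightarrow> is_presheaf I \<alpha> (K I \<Sigma> C)"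
  unfolding is_presheaf_def using term_sorts tact_term tact_Comp tact_Ident by auto

lemma computad_Cptd:
  assumes "is_presheaf I \<alpha> X"
  shows "computad I \<alpha> \<Sigma> (Cptd I X)"
proof (rule computadI)
  fix \<delta> v \<delta>' assume a: "\<delta> \<in> nonid I" "v \<in> Gen (Cptd I X) (Tgt I \<delta>)" "\<delta>' \<in> Arr I" "Tgt I \<delta>' = Src I \<delta>"
  have v: "Act X \<delta> v \<in> Car X (Src I \<delta>)" "Act X (Comp I \<delta> \<delta>') v = Act X \<delta>' (Act X \<delta> v)"
    using a assms by (auto simp: is_presheaf_def nonid_Arr)
  from a(3) show "tact I \<Sigma> (Cptd I X) \<delta>' (Glue (Cptd I X) \<delta> v) = Glue (Cptd I X) (Comp I \<delta> \<delta>') v"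
  proof (cases rule: Arr_cases)
    case (Ident i)
    then have "Comp I \<delta> \<delta>' = \<delta>" using a Comp_Ident_right[of \<delta>] by (simp add: Tgt_Ident nonid_Arr)
    then show ?thesis using Ident by (simp add: tact_Ident)
  next
    case nonid
    then show ?thesis using v a by (simp add: tact_nonid Src_Comp nonid_Arr)
  qed
qed (use assms nonid_Arr in \<open>auto simp: is_presheaf_def intro!: is_term.Var\<close>)

lemma is_presheaf_M: "is_presheaf I \<alpha> X \<Longrightarrow> is_presheaf I \<alpha> (M I \<Sigma> X)"
  unfolding M_def by (intro is_presheaf_Term computad_Cptd)

lemma cptd_mor_Cptd_map:
  assumes "is_presheaf I \<alpha> X" "presheaf_mor I X Y h"
  shows "cptd_mor I \<Sigma> (Cptd I X) (Cptd I Y) (Cptd_map X h)"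
proof (rule cptd_morI)
  fix \<delta> v assume "\<delta> \<in> nonid I" "v \<in> Gen (Cptd I X) (Tgt I \<delta>)"
  then show "tact I \<Sigma> (Cptd I Y) \<delta> (Cptd_map X h (Tgt I \<delta>) v) =
      subst \<Sigma> (Cptd_map X h) (Glue (Cptd I X) \<delta> v)"
    using assms by (auto simp: Cptd_map_def restr_apply tact_nonid is_presheaf_def presheaf_mor_def nonid_Arr)
qed (use presheaf_mor_Car[OF assms(2)] in \<open>auto simp: Cptd_map_def restr_apply intro!: is_term.Var\<close>)

lemma cptd_mor_eps:
  assumes "computad I \<alpha> \<Sigma> C"
  shows "cptd_mor I \<Sigma> (Cptd I (Term I \<Sigma> C)) C (eps I \<Sigma> C)"
proof (rule cptd_morI)
  fix \<delta> t assume "\<delta> \<in> nonid I" "t \<in> Gen (Cptd I (Term I \<Sigma> C)) (Tgt I \<delta>)"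
  then show "tact I \<Sigma> C \<delta> (eps I \<Sigma> C (Tgt I \<delta>) t) =
      subst \<Sigma> (eps I \<Sigma> C) (Glue (Cptd I (Term I \<Sigma> C)) \<delta> t)"
    using tact_term[OF assms, of \<delta> t] by (simp add: eps_apply nonid_Arr)
qed (auto simp: eps_def restr_apply)

lemma presheaf_mor_Term_map:
  assumes "computad I \<alpha> \<Sigma> C" "cptd_mor I \<Sigma> C D \<sigma>"
  shows "presheaf_mor I (Term I \<Sigma> C) (Term I \<Sigma> D) (Term_map I \<Sigma> C \<sigma>)"
  unfolding presheaf_mor_def
proof (intro conjI allI ballI)
  show "Term_map I \<Sigma> C \<sigma> i \<in> Car (Term I \<Sigma> C) i \<rightarrow>\<^sub>E Car (Term I \<Sigma> D) i" for i
    using subst_term[OF _ assms(2)] by (auto simp: Term_map_def restr_def)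
  fix \<delta> t assume d: "\<delta> \<in> Arr I" "t \<in> Car (Term I \<Sigma> C) (Tgt I \<delta>)"
  then have "is_term I \<Sigma> C (Src I \<delta>) (tact I \<Sigma> C \<delta> t)"
    using tact_term[OF assms(1)] by simp
  then show "Term_map I \<Sigma> C \<sigma> (Src I \<delta>) (Act (Term I \<Sigma> C) \<delta> t) =
      Act (Term I \<Sigma> D) \<delta> (Term_map I \<Sigma> C \<sigma> (Tgt I \<delta>) t)"
    using d tact_subst[OF assms(2)] by (simp add: Term_map_apply)
qed

lemma presheaf_mor_pcomp:
  assumes "is_presheaf I \<alpha> X" "presheaf_mor I X Y h" "presheaf_mor I Y Z g"
  shows "presheaf_mor I X Z (pcomp X g h)"
  unfolding presheaf_mor_def
proof (intro conjI allI ballI)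
  show "pcomp X g h i \<in> Car X i \<rightarrow>\<^sub>E Car Z i" for i
    using assms by (auto simp: presheaf_mor_def pcomp_apply PiE_iff extensional_def)
  fix \<delta> x assume "\<delta> \<in> Arr I" "x \<in> Car X (Tgt I \<delta>)"
  moreover have "h (Tgt I \<delta>) x \<in> Car Y (Tgt I \<delta>)" if "x \<in> Car X (Tgt I \<delta>)"
    using assms that by (auto simp: presheaf_mor_def)
  ultimately show "pcomp X g h (Src I \<delta>) (Act X \<delta> x) = Act Z \<delta> (pcomp X g h (Tgt I \<delta>) x)"
    using assms by (auto simp: presheaf_mor_def is_presheaf_def pcomp_apply)
qed

lemma is_alg_K:
  assumes "computad I \<alpha> \<Sigma> C"
  shows "is_alg I \<alpha> \<Sigma> (K I \<Sigma> C)"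
proof -
  let ?T = "Term I \<Sigma> C"
  note T = computad_Cptd[OF is_presheaf_Term[OF assms]]
  note e = cptd_mor_eps[OF assms]
  have p: "presheaf_mor I (M I \<Sigma> (K I \<Sigma> C)) (K I \<Sigma> C) (Ev (K I \<Sigma> C))"
    using presheaf_mor_Term_map[OF T e] by (simp add: M_def presheaf_mor_def)
  have "pcomp (K I \<Sigma> C) (Ev (K I \<Sigma> C)) (eta (K I \<Sigma> C)) = restr (Car (K I \<Sigma> C)) (\<lambda>i x. x)"
    by (auto simp: fun_eq_iff pcomp_apply eta_def restr_apply Term_map_apply eps_apply is_term.Var)
  moreover have "pcomp (M I \<Sigma> (M I \<Sigma> (K I \<Sigma> C))) (Ev (K I \<Sigma> C)) (M_map I \<Sigma> (M I \<Sigma> (K I \<Sigma> C)) (Ev (K I \<Sigma> C))) =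
       pcomp (M I \<Sigma> (M I \<Sigma> (K I \<Sigma> C))) (Ev (K I \<Sigma> C)) (mu I \<Sigma> (K I \<Sigma> C))"
    unfolding pcomp_eq_iff
  proof (intro allI ballI)
    fix i t assume "t \<in> Car (M I \<Sigma> (M I \<Sigma> (K I \<Sigma> C))) i"
    then have t: "is_term I \<Sigma> (Cptd I (M I \<Sigma> ?T)) i t" by (simp add: M_def)
    have TT: "is_presheaf I \<alpha> (M I \<Sigma> ?T)" using T unfolding M_def by (rule is_presheaf_Term)
    let ?h = "Term_map I \<Sigma> (Cptd I ?T) (eps I \<Sigma> C)"
    have h: "cptd_mor I \<Sigma> (Cptd I (M I \<Sigma> ?T)) (Cptd I ?T) (Cptd_map (M I \<Sigma> ?T) ?h)"
      by (rule cptd_mor_Cptd_map[OF TT]) (use presheaf_mor_Term_map[OF T e] in \<open>simp add: M_def\<close>)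
    have m: "cptd_mor I \<Sigma> (Cptd I (M I \<Sigma> ?T)) (Cptd I ?T) (eps I \<Sigma> (Cptd I ?T))"
      using cptd_mor_eps[OF T] by (simp add: M_def)
    have "subst \<Sigma> (eps I \<Sigma> C) (subst \<Sigma> (Cptd_map (M I \<Sigma> ?T) ?h) t) = subst \<Sigma> (\<lambda>i s. subst \<Sigma> (eps I \<Sigma> C) s) t"
    proof (rule subst_subst[OF t])
      fix i s assume "s \<in> Gen (Cptd I (M I \<Sigma> ?T)) i"
      then have s: "is_term I \<Sigma> (Cptd I ?T) i s" by (simp add: M_def)
      then show "subst \<Sigma> (eps I \<Sigma> C) (Cptd_map (M I \<Sigma> ?T) ?h i s) = subst \<Sigma> (eps I \<Sigma> C) s"
        using subst_term[OF s e] by (simp add: M_def Cptd_map_apply Term_map_apply eps_apply)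
    qed
    moreover have "subst \<Sigma> (eps I \<Sigma> C) (subst \<Sigma> (eps I \<Sigma> (Cptd I ?T)) t) = subst \<Sigma> (\<lambda>i s. subst \<Sigma> (eps I \<Sigma> C) s) t"
      by (rule subst_subst[OF t]) (simp add: M_def eps_apply)
    ultimately show "Ev (K I \<Sigma> C) i (M_map I \<Sigma> (M I \<Sigma> (K I \<Sigma> C)) (Ev (K I \<Sigma> C)) i t) =
        Ev (K I \<Sigma> C) i (mu I \<Sigma> (K I \<Sigma> C) i t)"
      using t subst_term[OF t h] subst_term[OF t m]
      by (simp add: M_map_def mu_def M_def Term_map_apply)
  qed
  ultimately show ?thesis
    using p is_presheaf_K[OF assms] by (simp add: is_alg_def)
qed

lemma alg_mor_K_map:
  assumes "computad I \<alpha> \<Sigma> C" "computad I \<alpha> \<Sigma> D" "cptd_mor I \<Sigma> C D \<sigma>"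
  shows "alg_mor I \<Sigma> (K I \<Sigma> C) (K I \<Sigma> D) (K_map I \<Sigma> C \<sigma>)"
  unfolding alg_mor_def pcomp_eq_iff
proof (intro conjI allI ballI)
  let ?TC = "Term I \<Sigma> C" and ?TD = "Term I \<Sigma> D" and ?h = "Term_map I \<Sigma> C \<sigma>"
  have h: "presheaf_mor I ?TC ?TD ?h" using presheaf_mor_Term_map[OF assms(1,3)] .
  then show "presheaf_mor I (K I \<Sigma> C) (K I \<Sigma> D) (K_map I \<Sigma> C \<sigma>)"
    by (simp add: presheaf_mor_def K_map_def)
  fix i t assume "t \<in> Car (M I \<Sigma> (K I \<Sigma> C)) i"
  then have t: "is_term I \<Sigma> (Cptd I ?TC) i t" by (simp add: M_def)
  have "subst \<Sigma> \<sigma> (subst \<Sigma> (eps I \<Sigma> C) t) = subst \<Sigma> (\<lambda>i s. subst \<Sigma> \<sigma> s) t"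
    by (rule subst_subst[OF t]) (simp add: eps_apply)
  moreover have "subst \<Sigma> (eps I \<Sigma> D) (subst \<Sigma> (Cptd_map ?TC ?h) t) = subst \<Sigma> (\<lambda>i s. subst \<Sigma> \<sigma> s) t"
    by (rule subst_subst[OF t])
      (use subst_term[OF _ assms(3)] in \<open>simp add: Cptd_map_apply Term_map_apply eps_apply\<close>)
  ultimately show "K_map I \<Sigma> C \<sigma> i (Ev (K I \<Sigma> C) i t) = Ev (K I \<Sigma> D) i (M_map I \<Sigma> (K I \<Sigma> C) (K_map I \<Sigma> C \<sigma>) i t)"
    using t subst_term[OF t cptd_mor_eps[OF assms(1)]]
      subst_term[OF t cptd_mor_Cptd_map[OF is_presheaf_Term[OF assms(1)] h]]
    by (simp add: K_map_def M_map_def Term_map_apply)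
qed

lemma initial_alg_ex1:
  fixes X :: "('i, 'm, 'f, 'b, 'x) alg"
  assumes "is_alg I \<alpha> \<Sigma> X"
  shows "\<exists>!h. alg_mor I \<Sigma> (initial_alg I \<Sigma>) X h"
proof (rule ex1I)
  let ?E = "empty_presheaf :: ('i, 'm, unit) presheaf"
  let ?D = "Cptd I ?E :: ('i, 'm, 'f, 'b, unit) cptd"
  let ?T = "Term I \<Sigma> ?D"
  let ?u = "Ev X"
  have X: "is_presheaf I \<alpha> X" "presheaf_mor I (M I \<Sigma> X) X ?u"
    and assoc: "pcomp (M I \<Sigma> (M I \<Sigma> X)) ?u (M_map I \<Sigma> (M I \<Sigma> X) ?u) = pcomp (M I \<Sigma> (M I \<Sigma> X)) ?u (mu I \<Sigma> X)"
    using assms by (auto simp: is_alg_def)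
  have E: "is_presheaf I \<alpha> ?E" by (simp add: is_presheaf_def empty_presheaf_def)
  note D = computad_Cptd[OF E]
  have noGen: "v \<notin> Gen ?D i" for v i by (simp add: empty_presheaf_def)
  define z :: "'i \<Rightarrow> unit \<Rightarrow> ('i, 'f, 'b, 'x) trm" where "z = (\<lambda>i v. undefined)"
  have z: "cptd_mor I \<Sigma> ?D (Cptd I X) z"
    by (rule cptd_morI) (use noGen in \<open>auto simp: z_def\<close>)
  define g where "g = Term_map I \<Sigma> ?D z"
  have g: "presheaf_mor I ?T (M I \<Sigma> X) g"
    unfolding g_def M_def by (rule presheaf_mor_Term_map[OF D z])
  define h where "h = pcomp ?T ?u g"
  have h: "presheaf_mor I ?T X h"
    unfolding h_def by (rule presheaf_mor_pcomp[OF is_presheaf_Term[OF D] g X(2)])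
  have h_apply: "h i t = ?u i (subst \<Sigma> z t)" if "is_term I \<Sigma> ?D i t" for i t
    using that by (simp add: h_def pcomp_apply g_def Term_map_apply)
  note T = is_presheaf_Term[OF D]
  have MM: "is_presheaf I \<alpha> (M I \<Sigma> X)" by (rule is_presheaf_M[OF X(1)])
  have CX: "computad I \<alpha> \<Sigma> (Cptd I X)" by (rule computad_Cptd[OF X(1)])
  show "alg_mor I \<Sigma> (initial_alg I \<Sigma>) X h"
    unfolding alg_mor_def initial_alg_def pcomp_eq_iff
  proof (intro conjI allI ballI)
    show "presheaf_mor I (K I \<Sigma> ?D) X h" using h by (simp add: presheaf_mor_def)
    fix i t assume "t \<in> Car (M I \<Sigma> (K I \<Sigma> ?D)) i"
    then have t: "is_term I \<Sigma> (Cptd I ?T) i t" by (simp add: M_def)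
    have gm: "cptd_mor I \<Sigma> (Cptd I ?T) (Cptd I (M I \<Sigma> X)) (Cptd_map ?T g)"
      by (rule cptd_mor_Cptd_map[OF T g])
    define s where "s = subst \<Sigma> (Cptd_map ?T g) t"
    have s: "is_term I \<Sigma> (Cptd I (M I \<Sigma> X)) i s"
      unfolding s_def by (rule subst_term[OF t gm])
    have "?u i (M_map I \<Sigma> (M I \<Sigma> X) ?u i s) = ?u i (mu I \<Sigma> X i s)"
      using assoc s unfolding pcomp_eq_iff by (simp add: M_def)
    then have 1: "?u i (subst \<Sigma> (Cptd_map (M I \<Sigma> X) ?u) s) = ?u i (subst \<Sigma> (eps I \<Sigma> (Cptd I X)) s)"
      using s by (simp add: M_map_def mu_def Term_map_apply)
    have 2: "subst \<Sigma> (Cptd_map (M I \<Sigma> X) ?u) s = subst \<Sigma> (Cptd_map ?T h) t"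
      unfolding s_def
      by (rule subst_subst[OF t])
        (use presheaf_mor_Car[OF g] in \<open>simp add: Cptd_map_apply h_def pcomp_apply\<close>)
    have 3: "subst \<Sigma> (eps I \<Sigma> (Cptd I X)) s = subst \<Sigma> (\<lambda>i r. subst \<Sigma> z r) t"
      unfolding s_def
      by (rule subst_subst[OF t])
        (use subst_term[OF _ z] in \<open>simp add: Cptd_map_apply g_def Term_map_apply eps_apply\<close>)
    have 4: "subst \<Sigma> z (subst \<Sigma> (eps I \<Sigma> ?D) t) = subst \<Sigma> (\<lambda>i r. subst \<Sigma> z r) t"
      by (rule subst_subst[OF t]) (simp add: eps_apply)
    show "h i (Ev (K I \<Sigma> ?D) i t) = ?u i (M_map I \<Sigma> (K I \<Sigma> ?D) h i t)"
      using t subst_term[OF t cptd_mor_eps[OF D]] 1 2 3 4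
      by (simp add: M_map_def Term_map_apply h_apply)
  qed
  fix k assume k: "alg_mor I \<Sigma> (initial_alg I \<Sigma>) X k"
  show "k = h"
  proof (intro ext)
    fix i t
    show "k i t = h i t"
    proof (cases "is_term I \<Sigma> ?D i t")
      case True
      define s :: "('i, 'f, 'b, ('i, 'f, 'b, unit) trm) trm"
        where "s = subst \<Sigma> (\<lambda>i v. undefined) t"
      have w: "cptd_mor I \<Sigma> ?D (Cptd I ?T) (\<lambda>i v. undefined)"
        by (rule cptd_morI) (use noGen in auto)
      have s: "is_term I \<Sigma> (Cptd I ?T) i s"
        unfolding s_def by (rule subst_term[OF True w])
      have "subst \<Sigma> (eps I \<Sigma> ?D) s = subst \<Sigma> Var t"
        unfolding s_def by (rule subst_subst[OF True]) (use noGen in auto)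
      then have 1: "subst \<Sigma> (eps I \<Sigma> ?D) s = t"
        using subst_ident[OF True, of Var] by simp
      have 2: "subst \<Sigma> (Cptd_map ?T k) s = subst \<Sigma> z t"
        unfolding s_def by (rule subst_subst[OF True]) (use noGen in auto)
      have "k i (Ev (K I \<Sigma> ?D) i s) = ?u i (M_map I \<Sigma> (K I \<Sigma> ?D) k i s)"
        using k s unfolding alg_mor_def initial_alg_def pcomp_eq_iff by (simp add: M_def)
      then show ?thesis
        using s 1 2 True by (simp add: M_map_def Term_map_apply h_apply)
    next
      case False
      then show ?thesis
        using k by (simp add: h_def pcomp_apply alg_mor_def initial_alg_def presheaf_mor_def
            PiE_iff extensional_def)
    qed
  qed
qed

lemma is_alg_initial_alg: "is_alg I \<alpha> \<Sigma> (initial_alg I \<Sigma>)"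
  unfolding initial_alg_def
  by (intro is_alg_K computad_Cptd) (simp add: is_presheaf_def empty_presheaf_def)

end

end

theory Submission
  imports Defs
begin

text \<open>
  A morphism of algebras out of the free algebra on \<open>C\<close> is the same thing as a choice of images
  of the generators of \<open>C\<close> that is compatible with the gluing functions; the images of all other
  terms are then found by evaluation. A lift of \<open>b\<close> along a trivial fibration \<open>p\<close> is thus chosen
  generator by generator, by recursion on the dimension: the faces of a generator \<open>v\<close> are terms
  in generators of smaller dimension, so their evaluations are already known. They amount to a
  morphism out of the boundary of a disc, while the image of \<open>v\<close> under \<open>b\<close> is a disc in the
  target of \<open>p\<close>, and the lifting property against the boundary inclusion yields the image of
  \<open>v\<close>. The triangle under the initial algebra commutes by initiality.
\<close>

text \<open>Arguments are evaluated before the symbol is applied, and \<open>Cptd_map\<close>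
  returns their values as variables, so \<open>Ev\<close> only sees terms with a single symbol over
  \<open>Y\<close>. Replacing all generators by elements at once would not do: faces of a generator
  of \<open>C\<close> can be composite terms while those of a generator of \<open>Cptd I Y\<close>
  are variables, so the result need not be a term over \<open>Y\<close>.\<close>

primrec eval_trm :: "('i, 'm, 'f, 'b) sig \<Rightarrow> ('i, 'm, 'f, 'b, 'y) alg \<Rightarrow> ('i \<Rightarrow> 'v \<Rightarrow> 'y) \<Rightarrow>
    ('i, 'f, 'b, 'v) trm \<Rightarrow> 'y" where
  "eval_trm \<Sigma> Y s (Var i v) = s i v"
| "eval_trm \<Sigma> Y s (Fun i f \<tau>) =
     Ev Y i (Fun i f (Cptd_map (Arity \<Sigma> i f) (\<lambda>j b. eval_trm \<Sigma> Y s (\<tau> j b))))"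

lemma Cptd_map_cong:
  "(\<And>i x. x \<in> Car X i \<Longrightarrow> h i x = h' i x) \<Longrightarrow> Cptd_map X h = Cptd_map X h'"
  by (simp add: Cptd_map_def cong: restr_eqI)

lemma eval_trm_cong:
  assumes "is_term I \<Sigma> C i t" "\<And>i v. v \<in> Gen C i \<Longrightarrow> s i v = s' i v"
  shows "eval_trm \<Sigma> Y s t = eval_trm \<Sigma> Y s' t"
  using assms(1)
proof (induction rule: is_term_induct)
  case (Fun f i \<tau>)
  then show ?case
    by (auto intro!: Cptd_map_cong arg_cong[where f = "\<lambda>\<tau>. Ev Y i (Fun i f \<tau>)"])
qed (simp add: assms(2))

text \<open>Evaluation reads the signature only through its arities, which truncation keeps. Gluing
  terms can thus be evaluated over the truncation in which they live.\<close>

lemma eval_trm_tr_sig [simp]: "eval_trm (tr_sig I \<beta> \<Sigma>) Y s t = eval_trm \<Sigma> Y s t"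
proof (induction t)
  case (Fun i f \<tau>)
  then show ?case
    by (auto intro!: Cptd_map_cong arg_cong[where f = "\<lambda>\<tau>. Ev Y i (Fun i f \<tau>)"])
qed simp

lemma is_alg_presheaf: "is_alg I \<alpha> \<Sigma> Y \<Longrightarrow> is_presheaf I \<alpha> Y"
  and is_alg_Ev_mor: "is_alg I \<alpha> \<Sigma> Y \<Longrightarrow> presheaf_mor I (M I \<Sigma> Y) Y (Ev Y)"
  by (simp_all add: is_alg_def)

lemma is_alg_Ev_Var:
  assumes "is_alg I \<alpha> \<Sigma> Y" "y \<in> Car Y i"
  shows "Ev Y i (Var i y) = y"
proof -
  have "pcomp Y (Ev Y) (eta Y) i y = restr (Car Y) (\<lambda>i x. x) i y"
    using assms(1) by (simp add: is_alg_def)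
  then show ?thesis using assms(2) by (simp add: pcomp_apply eta_def restr_apply)
qed

lemma alg_mor_presheaf_mor: "alg_mor I \<Sigma> X Y h \<Longrightarrow> presheaf_mor I X Y h"
  by (simp add: alg_mor_def)

lemma presheaf_mor_undefined: "presheaf_mor I X Y h \<Longrightarrow> x \<notin> Car X i \<Longrightarrow> h i x = undefined"
  by (auto simp: presheaf_mor_def PiE_iff extensional_def)

lemma presheaf_mor_Act: "\<lbrakk>presheaf_mor I X Y h; \<delta> \<in> Arr I; x \<in> Car X (Tgt I \<delta>)\<rbrakk>
    \<Longrightarrow> h (Src I \<delta>) (Act X \<delta> x) = Act Y \<delta> (h (Tgt I \<delta>) x)"
  by (simp add: presheaf_mor_def)

lemma presheaf_mor_ext:
  assumes "presheaf_mor I X Y h" "presheaf_mor I X Y h'"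
    and "\<And>i x. x \<in> Car X i \<Longrightarrow> h i x = h' i x"
  shows "h = h'"
  using assms presheaf_mor_undefined by (metis ext)

lemma alg_mor_Ev:
  assumes "alg_mor I \<Sigma> X Y h" "is_term I \<Sigma> (Cptd I X) i t"
  shows "h i (Ev X i t) = Ev Y i (subst \<Sigma> (Cptd_map X h) t)"
  using assms unfolding alg_mor_def pcomp_eq_iff by (simp add: M_def M_map_def Term_map_apply)

lemma subst_Fun_Cptd_map:
  assumes "\<And>j b. b \<in> Car (Arity \<Sigma> i f) j \<Longrightarrow> h j b \<in> Car X j"
  shows "subst \<Sigma> (Cptd_map X g) (Fun i f (Cptd_map (Arity \<Sigma> i f) h)) =
    Fun i f (Cptd_map (Arity \<Sigma> i f) (\<lambda>j b. g j (h j b)))"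
  using assms by (auto simp: Cptd_map_def restr_apply intro!: restr_eqI)

section \<open>Evaluation, substitution and the associativity law of the action\<close>

context sorted_signature
begin

lemma is_presheaf_Arity: "f \<in> Sym \<Sigma> i \<Longrightarrow> is_presheaf I \<alpha> (Arity \<Sigma> i f)"
  using Arity_presheaf[of f i] Sym_sorts[of f i]
  by (fastforce simp: is_presheaf_def sorts_def)

lemma is_term_Fun_Cptd_map:
  assumes "f \<in> Sym \<Sigma> i" "presheaf_mor I (Arity \<Sigma> i f) Y h"
  shows "is_term I \<Sigma> (Cptd I Y) i (Fun i f (Cptd_map (Arity \<Sigma> i f) h))"
  using cptd_mor_Cptd_map[OF is_presheaf_Arity assms(2)] assms(1)
  by (auto simp: is_term_cases[of I \<Sigma> "Cptd I Y"])

text \<open>Transposition along the adjunction between \<open>Cptd\<close> and \<open>Term\<close>: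
  the gluing condition is naturality along non-identity face maps, and identities act trivially on
  both sides.\<close>

lemma cptd_mor_Cptd_presheaf_mor:
  assumes "cptd_mor I \<Sigma> (Cptd I X) C \<sigma>" "is_presheaf I \<alpha> X"
  shows "presheaf_mor I X (Term I \<Sigma> C) \<sigma>"
  unfolding presheaf_mor_def
proof (intro conjI allI ballI)
  show "\<sigma> i \<in> Car X i \<rightarrow>\<^sub>E Car (Term I \<Sigma> C) i" for i
    using cptd_mor_term[OF assms(1)] cptd_mor_undefined[OF assms(1)]
    by (auto simp: PiE_iff extensional_def)
  fix \<delta> x assume d: "\<delta> \<in> Arr I" "x \<in> Car X (Tgt I \<delta>)"
  show "\<sigma> (Src I \<delta>) (Act X \<delta> x) = Act (Term I \<Sigma> C) \<delta> (\<sigma> (Tgt I \<delta>) x)"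
    using d(1)
  proof (cases rule: Arr_cases)
    case (Ident i)
    then show ?thesis
      using d assms(2) by (simp add: is_presheaf_def tact_Ident Src_Ident Tgt_Ident)
  next
    case nonid
    then show ?thesis using cptd_mor_glue[OF assms(1) nonid, of x] d by simp
  qed
qed

text \<open>The associativity law at a two-layer term with \<open>f\<close> outside and the terms
  \<open>\<sigma> j b\<close> inside. The multiplication flattens it to
  \<open>Fun i f \<sigma>\<close>, while mapping \<open>Ev\<close> over it evaluates the inner terms
  first.\<close>

lemma Ev_Fun_assoc:
  assumes Y: "is_alg I \<alpha> \<Sigma> Y" and f: "f \<in> Sym \<Sigma> i"
    and \<sigma>: "cptd_mor I \<Sigma> (Cptd I (Arity \<Sigma> i f)) (Cptd I Y) \<sigma>"
  shows "Ev Y i (Fun i f (Cptd_map (Arity \<Sigma> i f) (\<lambda>j b. Ev Y j (\<sigma> j b)))) = Ev Y i (Fun i f \<sigma>)"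
proof -
  let ?B = "Arity \<Sigma> i f"
  have p: "presheaf_mor I ?B (M I \<Sigma> Y) \<sigma>"
    unfolding M_def by (rule cptd_mor_Cptd_presheaf_mor[OF \<sigma> is_presheaf_Arity[OF f]])
  define s where "s = Fun i f (Cptd_map ?B \<sigma>)"
  have s: "is_term I \<Sigma> (Cptd I (M I \<Sigma> Y)) i s"
    unfolding s_def by (rule is_term_Fun_Cptd_map[OF f p])
  have "Ev Y i (M_map I \<Sigma> (M I \<Sigma> Y) (Ev Y) i s) = Ev Y i (mu I \<Sigma> Y i s)"
    using Y s unfolding is_alg_def pcomp_eq_iff by (simp add: M_def)
  moreover have "subst \<Sigma> (eps I \<Sigma> (Cptd I Y)) s = Fun i f \<sigma>"
    using cptd_mor_term[OF \<sigma>] cptd_mor_undefined[OF \<sigma>]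
    by (auto simp: s_def fun_eq_iff restr_apply Cptd_map_def eps_apply)
  moreover have "subst \<Sigma> (Cptd_map (M I \<Sigma> Y) (Ev Y)) s =
      Fun i f (Cptd_map ?B (\<lambda>j b. Ev Y j (\<sigma> j b)))"
    unfolding s_def by (rule subst_Fun_Cptd_map) (rule presheaf_mor_Car[OF p])
  ultimately show ?thesis using s by (simp add: M_map_def mu_def Term_map_apply)
qed

text \<open>Induction extends \<open>Ev_Fun_assoc\<close> to terms \<open>u\<close> of any depth. It
  serves twice: with \<open>u\<close> a boundary term over an arity, for naturality of evaluation,
  and with \<open>\<sigma>\<close> the counit, for compatibility with the action on
  \<open>K I \<Sigma> C\<close>.\<close>

lemma eval_trm_subst:
  assumes Y: "is_alg I \<alpha> \<Sigma> Y" and X: "is_presheaf I \<alpha> X"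
    and h: "presheaf_mor I X Y h"
    and eq: "\<And>i x. x \<in> Car X i \<Longrightarrow> eval_trm \<Sigma> Y s (\<sigma> i x) = h i x"
    and u: "is_term I \<Sigma> (Cptd I X) i u"
  shows "eval_trm \<Sigma> Y s (subst \<Sigma> \<sigma> u) = Ev Y i (subst \<Sigma> (Cptd_map X h) u)"
  using u
proof (induction rule: is_term_induct)
  case (Var v i)
  then show ?case
    using presheaf_mor_Car[OF h] by (simp add: eq Cptd_map_apply is_alg_Ev_Var[OF Y])
next
  case (Fun g i \<rho>)
  let ?B = "Arity \<Sigma> i g"
  let ?\<rho> = "restr (Car ?B) (\<lambda>j b. subst \<Sigma> (Cptd_map X h) (\<rho> j b))"
  have t: "is_term I \<Sigma> (Cptd I X) i (Fun i g \<rho>)"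
    using Fun(1,2) by (auto simp: is_term_cases[of I \<Sigma> "Cptd I X"])
  \<comment> \<open>Associativity asks for a morphism of computads; inverting termhood of the
    substituted term shows that \<open>?\<rho>\<close> is one.\<close>
  have "is_term I \<Sigma> (Cptd I Y) i (Fun i g ?\<rho>)"
    using subst_term[OF t cptd_mor_Cptd_map[OF X h]] by simp
  then have "cptd_mor I \<Sigma> (Cptd I ?B) (Cptd I Y) ?\<rho>"
    by (auto simp: is_term_cases[of I \<Sigma> "Cptd I Y"])
  from Ev_Fun_assoc[OF Y Fun(1) this]
  have "Ev Y i (Fun i g ?\<rho>) = Ev Y i (Fun i g (Cptd_map ?B (\<lambda>j b. Ev Y j (?\<rho> j b))))" by simp
  also have "Cptd_map ?B (\<lambda>j b. Ev Y j (?\<rho> j b)) =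
      Cptd_map ?B (\<lambda>j b. eval_trm \<Sigma> Y s (restr (Car ?B) (\<lambda>j b. subst \<Sigma> \<sigma> (\<rho> j b)) j b))"
    by (rule Cptd_map_cong) (simp add: restr_apply Fun.IH)
  finally show ?case by simp
qed

text \<open>
  Naturality is required on generators of dimension at most \<open>\<beta>\<close> only, so that the notion
  makes sense for a lift that has so far been constructed below a given dimension.
\<close>

definition natural_data :: "'o \<Rightarrow> ('i, 'm, 'f, 'b, 'v) cptd \<Rightarrow> ('i, 'm, 'f, 'b, 'y) alg \<Rightarrow>
    ('i \<Rightarrow> 'v \<Rightarrow> 'y) \<Rightarrow> bool" where
  "natural_data \<beta> C Y s \<longleftrightarrow> (\<forall>i\<in>sorts I \<beta>. \<forall>v\<in>Gen C i. s i v \<in> Car Y i \<and>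
     (\<forall>\<delta>\<in>nonid I. Tgt I \<delta> = i \<longrightarrow> Act Y \<delta> (s i v) = eval_trm \<Sigma> Y s (Glue C \<delta> v)))"

text \<open>Membership and naturality are proved together, since for a function symbol both are
  needed to see that the evaluated arguments form a presheaf morphism \<open>h\<close>. The
  arguments stay within dimension \<open>\<beta>\<close> because an arity is empty above the
  dimension of the sort of its symbol.\<close>

lemma eval_trm_natural:
  assumes Y: "is_alg I \<alpha> \<Sigma> Y" and s: "natural_data \<beta> C Y s"
    and t: "is_term I \<Sigma> C i t" "i \<in> sorts I \<beta>"
  shows "eval_trm \<Sigma> Y s t \<in> Car Y i \<and>
    (\<forall>\<delta>\<in>Arr I. Tgt I \<delta> = i \<longrightarrow> Act Y \<delta> (eval_trm \<Sigma> Y s t) = eval_trm \<Sigma> Y s (tact I \<Sigma> C \<delta> t))"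
  using t
proof (induction rule: is_term_induct)
  case (Var v i)
  then have v: "s i v \<in> Car Y i"
    "\<And>\<delta>. \<delta> \<in> nonid I \<Longrightarrow> Tgt I \<delta> = i \<Longrightarrow> Act Y \<delta> (s i v) = eval_trm \<Sigma> Y s (Glue C \<delta> v)"
    using s by (auto simp: natural_data_def)
  have "Act Y \<delta> (s i v) = eval_trm \<Sigma> Y s (tact I \<Sigma> C \<delta> (Var i v))"
    if "\<delta> \<in> Arr I" "Tgt I \<delta> = i" for \<delta>
    using that(1)
  proof (cases rule: Arr_cases)
    case (Ident k)
    then show ?thesis
      using that v is_alg_presheaf[OF Y] by (simp add: is_presheaf_def tact_Ident Tgt_Ident)
  next
    case nonid
    then show ?thesis using v that by (simp add: tact_nonid)
  qed
  then show ?case using v by simp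
next
  case (Fun f i \<tau>)
  let ?B = "Arity \<Sigma> i f"
  note B = is_presheaf_Arity[OF Fun(1)]
  define h where "h = restr (Car ?B) (\<lambda>j b. eval_trm \<Sigma> Y s (\<tau> j b))"
  have IH: "eval_trm \<Sigma> Y s (\<tau> j b) \<in> Car Y j"
    "\<And>\<delta>. \<delta> \<in> Arr I \<Longrightarrow> Tgt I \<delta> = j \<Longrightarrow>
      Act Y \<delta> (eval_trm \<Sigma> Y s (\<tau> j b)) = eval_trm \<Sigma> Y s (tact I \<Sigma> C \<delta> (\<tau> j b))"
    if "b \<in> Car ?B j" for j b
    using Fun.IH[OF that Arity_sorts[OF Fun(1) that Fun.prems]] by auto
  have h: "presheaf_mor I ?B Y h"
    unfolding presheaf_mor_def
  proof (intro conjI allI ballI)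
    show "h j \<in> Car ?B j \<rightarrow>\<^sub>E Car Y j" for j
      using IH(1) by (auto simp: h_def restr_def)
    fix \<delta> b assume d: "\<delta> \<in> Arr I" "b \<in> Car ?B (Tgt I \<delta>)"
    then have a: "Act ?B \<delta> b \<in> Car ?B (Src I \<delta>)" using B by (simp add: is_presheaf_def)
    have "\<tau> (Src I \<delta>) (Act ?B \<delta> b) = tact I \<Sigma> C \<delta> (\<tau> (Tgt I \<delta>) b)"
      using presheaf_mor_Act[OF cptd_mor_Cptd_presheaf_mor[OF Fun(2) B] d] by simp
    then show "h (Src I \<delta>) (Act ?B \<delta> b) = Act Y \<delta> (h (Tgt I \<delta>) b)"
      using d a IH(2)[OF d(2)] by (simp add: h_def restr_apply)
  qed
  have eq: "eval_trm \<Sigma> Y s (Fun i f \<tau>) = Ev Y i (Fun i f (Cptd_map ?B h))"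
    by (simp, rule arg_cong[OF Cptd_map_cong]) (simp add: h_def restr_apply)
  let ?t = "Fun i f (Cptd_map ?B h)"
  have tm: "is_term I \<Sigma> (Cptd I Y) i ?t" by (rule is_term_Fun_Cptd_map[OF Fun(1) h])
  then have car: "Ev Y i ?t \<in> Car Y i"
    using presheaf_mor_Car[OF is_alg_Ev_mor[OF Y]] by (simp add: M_def)
  have "Act Y \<delta> (Ev Y i ?t) = eval_trm \<Sigma> Y s (tact I \<Sigma> C \<delta> (Fun i f \<tau>))"
    if d: "\<delta> \<in> Arr I" "Tgt I \<delta> = i" for \<delta>
    using that(1)
  proof (cases rule: Arr_cases)
    case (Ident k)
    then show ?thesis
      using d car is_alg_presheaf[OF Y]
      by (simp add: is_presheaf_def tact_Ident Tgt_Ident eq del: eval_trm.simps)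
  next
    case nonid
    have f: "f \<in> Sym \<Sigma> (Tgt I \<delta>)" using Fun(1) d by simp
    \<comment> \<open>Naturality of \<open>Ev\<close> moves the face map onto \<open>?t\<close>,
      whose face is a boundary term with \<open>h\<close> substituted; \<open>eval_trm_subst\<close>
      then trades \<open>h\<close> for \<open>\<tau>\<close>.\<close>
    have "Act Y \<delta> (Ev Y i ?t) = Ev Y (Src I \<delta>) (tact I \<Sigma> (Cptd I Y) \<delta> ?t)"
      using presheaf_mor_Act[OF is_alg_Ev_mor[OF Y] d(1), of ?t] tm d by (simp add: M_def)
    also have "\<dots> = Ev Y (Src I \<delta>) (subst \<Sigma> (Cptd_map ?B h) (Bdry \<Sigma> \<delta> f))"
      using nonid by (simp add: tact_nonid)
    also have "\<dots> = eval_trm \<Sigma> Y s (subst \<Sigma> \<tau> (Bdry \<Sigma> \<delta> f))"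
      using Bdry_term[OF nonid f] d
      by (intro eval_trm_subst[OF Y B h, symmetric]) (simp_all add: h_def restr_apply)
    finally show ?thesis using nonid by (simp add: tact_nonid)
  qed
  then show ?case using car by (simp only: eq) blast
qed

section \<open>The universal property of free algebras: existence and uniqueness of morphisms out of
  \<open>K I \<Sigma> C\<close>\<close>

lemma alg_mor_eval_trm:
  assumes Y: "is_alg I \<alpha> \<Sigma> Y" and C: "computad I \<alpha> \<Sigma> C" and s: "natural_data \<alpha> C Y s"
  shows "alg_mor I \<Sigma> (K I \<Sigma> C) Y (restr (Car (K I \<Sigma> C)) (\<lambda>i. eval_trm \<Sigma> Y s))"
    (is "alg_mor I \<Sigma> _ Y ?h")
proof -
  have e: "eval_trm \<Sigma> Y s t \<in> Car Y i"
    "\<And>\<delta>. \<delta> \<in> Arr I \<Longrightarrow> Tgt I \<delta> = i \<Longrightarrow>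
      Act Y \<delta> (eval_trm \<Sigma> Y s t) = eval_trm \<Sigma> Y s (tact I \<Sigma> C \<delta> t)"
    if "is_term I \<Sigma> C i t" for i t
    using eval_trm_natural[OF Y s that term_sorts[OF that C]] by auto
  have h: "presheaf_mor I (K I \<Sigma> C) Y ?h"
    using e tact_term[OF C] by (auto simp: presheaf_mor_def restr_def)
  then have h': "presheaf_mor I (Term I \<Sigma> C) Y ?h" by (simp add: presheaf_mor_def)
  show ?thesis
    unfolding alg_mor_def pcomp_eq_iff
  proof (intro conjI allI ballI h)
    fix i t assume "t \<in> Car (M I \<Sigma> (K I \<Sigma> C)) i"
    then have t: "is_term I \<Sigma> (Cptd I (Term I \<Sigma> C)) i t" by (simp add: M_def)
    \<comment> \<open>The action on \<open>K I \<Sigma> C\<close> flattens \<open>t\<close> by the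
      counit, so the square for \<open>Ev\<close> is \<open>eval_trm_subst\<close> at the presheaf
      of terms.\<close>
    have "eval_trm \<Sigma> Y s (subst \<Sigma> (eps I \<Sigma> C) t) = Ev Y i (subst \<Sigma> (Cptd_map (Term I \<Sigma> C) ?h) t)"
      by (rule eval_trm_subst[OF Y is_presheaf_Term[OF C] h' _ t]) (simp add: eps_apply restr_apply)
    then show "?h i (Ev (K I \<Sigma> C) i t) = Ev Y i (M_map I \<Sigma> (K I \<Sigma> C) ?h i t)"
      using t subst_term[OF t cptd_mor_eps[OF C]]
      by (simp add: restr_apply M_map_def Term_map_apply)
  qed
qed

text \<open>\<open>Fun i f \<tau>\<close> is itself a value of the action on
  \<open>K I \<Sigma> C\<close>, at the one-symbol term \<open>?t\<close> whose arguments are the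
  \<open>\<tau> j b\<close> as variables; morphisms of algebras preserve this value.\<close>

lemma alg_mor_K_Fun:
  assumes "computad I \<alpha> \<Sigma> C" "alg_mor I \<Sigma> (K I \<Sigma> C) Z k"
    and f: "f \<in> Sym \<Sigma> i" and \<tau>: "cptd_mor I \<Sigma> (Cptd I (Arity \<Sigma> i f)) C \<tau>"
  shows "k i (Fun i f \<tau>) = Ev Z i (Fun i f (Cptd_map (Arity \<Sigma> i f) (\<lambda>j b. k j (\<tau> j b))))"
proof -
  let ?B = "Arity \<Sigma> i f"
  have p: "presheaf_mor I ?B (Term I \<Sigma> C) \<tau>"
    by (rule cptd_mor_Cptd_presheaf_mor[OF \<tau> is_presheaf_Arity[OF f]])
  let ?t = "Fun i f (Cptd_map ?B \<tau>)"
  have t: "is_term I \<Sigma> (Cptd I (K I \<Sigma> C)) i ?t"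
    using is_term_Fun_Cptd_map[OF f p] by simp
  have "Ev (K I \<Sigma> C) i ?t = Fun i f \<tau>"
    using t cptd_mor_term[OF \<tau>] cptd_mor_undefined[OF \<tau>]
    by (auto simp: Term_map_apply fun_eq_iff restr_apply Cptd_map_def eps_apply)
  moreover have "subst \<Sigma> (Cptd_map (K I \<Sigma> C) k) ?t =
      Fun i f (Cptd_map ?B (\<lambda>j b. k j (\<tau> j b)))"
    by (rule subst_Fun_Cptd_map) (use cptd_mor_term[OF \<tau>] in simp)
  ultimately show ?thesis using alg_mor_Ev[OF assms(2) t] by simp
qed

text \<open>Every term arises from variables by the action, so \<open>alg_mor_K_Fun\<close>
  propagates agreement on generators.\<close>

lemma alg_mor_K_unique:
  assumes "computad I \<alpha> \<Sigma> C" "alg_mor I \<Sigma> (K I \<Sigma> C) Z k" "alg_mor I \<Sigma> (K I \<Sigma> C) Z k'"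
    and "\<And>i v. v \<in> Gen C i \<Longrightarrow> k i (Var i v) = k' i (Var i v)"
  shows "k = k'"
proof (rule presheaf_mor_ext[OF assms(2,3)[THEN alg_mor_presheaf_mor]])
  fix i t assume "t \<in> Car (K I \<Sigma> C) i"
  then have "is_term I \<Sigma> C i t" by simp
  then show "k i t = k' i t"
  proof (induction rule: is_term_induct)
    case (Fun f i \<tau>)
    have "Fun i f (Cptd_map (Arity \<Sigma> i f) (\<lambda>j b. k j (\<tau> j b))) =
        Fun i f (Cptd_map (Arity \<Sigma> i f) (\<lambda>j b. k' j (\<tau> j b)))"
      by (rule arg_cong[OF Cptd_map_cong]) (rule Fun.IH)
    then show ?case
      by (simp only: alg_mor_K_Fun[OF assms(1,2) Fun(1,2)] alg_mor_K_Fun[OF assms(1,3) Fun(1,2)])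
  qed (rule assms(4))
qed

lemma alg_mor_pcomp:
  assumes "is_alg I \<alpha> \<Sigma> X" and h: "alg_mor I \<Sigma> X Y h" and g: "alg_mor I \<Sigma> Y Z g"
  shows "alg_mor I \<Sigma> X Z (pcomp X g h)"
  unfolding alg_mor_def pcomp_eq_iff
proof (intro conjI allI ballI)
  note X = is_alg_presheaf[OF assms(1)] and XX = is_alg_Ev_mor[OF assms(1)]
  note hp = alg_mor_presheaf_mor[OF h] and gp = alg_mor_presheaf_mor[OF g]
  show "presheaf_mor I X Z (pcomp X g h)"
    by (rule presheaf_mor_pcomp[OF X hp gp])
  fix i t assume t: "t \<in> Car (M I \<Sigma> X) i"
  then have tm: "is_term I \<Sigma> (Cptd I X) i t" by (simp add: M_def)
  have "subst \<Sigma> (Cptd_map Y g) (subst \<Sigma> (Cptd_map X h) t) = subst \<Sigma> (Cptd_map X (pcomp X g h)) t"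
    by (rule subst_subst[OF tm])
      (use presheaf_mor_Car[OF hp] in \<open>simp add: Cptd_map_apply pcomp_apply\<close>)
  then show "pcomp X g h i (Ev X i t) = Ev Z i (M_map I \<Sigma> X (pcomp X g h) i t)"
    using presheaf_mor_Car[OF XX t] tm alg_mor_Ev[OF h tm]
      alg_mor_Ev[OF g subst_term[OF tm cptd_mor_Cptd_map[OF X hp]]]
    by (simp add: pcomp_apply M_map_def Term_map_apply)
qed

text \<open>Data natural up to \<open>\<beta>\<close> need not yet define a morphism out of
  \<open>K I \<Sigma> C\<close>, so \<open>alg_mor_K_unique\<close> cannot compare the two sides;
  the induction is run on sorts within \<open>\<beta>\<close> instead.\<close>

lemma alg_mor_eval_trm_eq:
  assumes Y: "is_alg I \<alpha> \<Sigma> Y" and p: "alg_mor I \<Sigma> Y Z p"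
    and C: "computad I \<alpha> \<Sigma> C" and b: "alg_mor I \<Sigma> (K I \<Sigma> C) Z b"
    and s: "natural_data \<beta> C Y s"
    and eq: "\<And>i v. i \<in> sorts I \<beta> \<Longrightarrow> v \<in> Gen C i \<Longrightarrow> p i (s i v) = b i (Var i v)"
    and t: "is_term I \<Sigma> C i t" "i \<in> sorts I \<beta>"
  shows "p i (eval_trm \<Sigma> Y s t) = b i t"
  using t
proof (induction rule: is_term_induct)
  case (Fun f i \<tau>)
  let ?B = "Arity \<Sigma> i f"
  note B = is_presheaf_Arity[OF Fun(1)]
  have js: "j \<in> sorts I \<beta>" if "b \<in> Car ?B j" for j b
    by (rule Arity_sorts[OF Fun(1) that Fun.prems])
  note e = eval_trm_natural[OF Y s Fun(3) js]
  define h where "h = restr (Car ?B) (\<lambda>j b. eval_trm \<Sigma> Y s (\<tau> j b))"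
  have "presheaf_mor I ?B (Term I \<Sigma> C) \<tau>"
    by (rule cptd_mor_Cptd_presheaf_mor[OF Fun(2) B])
  then have h: "presheaf_mor I ?B Y h"
    using e B unfolding presheaf_mor_def is_presheaf_def
    by (auto simp: h_def restr_apply PiE_iff extensional_def)
  have tm: "is_term I \<Sigma> (Cptd I Y) i (Fun i f (Cptd_map ?B h))"
    by (rule is_term_Fun_Cptd_map[OF Fun(1) h])
  have "p i (eval_trm \<Sigma> Y s (Fun i f \<tau>)) = p i (Ev Y i (Fun i f (Cptd_map ?B h)))"
    by (simp add: h_def restr_apply cong: Cptd_map_cong)
  also have "\<dots> = Ev Z i (subst \<Sigma> (Cptd_map Y p) (Fun i f (Cptd_map ?B h)))"
    by (rule alg_mor_Ev[OF p tm])
  also have "\<dots> = Ev Z i (Fun i f (Cptd_map ?B (\<lambda>j b. p j (h j b))))"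
    by (subst subst_Fun_Cptd_map) (simp_all add: presheaf_mor_Car[OF h])
  also have "Cptd_map ?B (\<lambda>j b. p j (h j b)) = Cptd_map ?B (\<lambda>j c. b j (\<tau> j c))"
    by (rule Cptd_map_cong) (simp add: h_def restr_apply Fun.IH js)
  also have "Ev Z i (Fun i f \<dots>) = b i (Fun i f \<tau>)"
    by (rule alg_mor_K_Fun[OF C b Fun(1,2), symmetric])
  finally show ?case .
qed (simp add: eq)

section \<open>Lifting against boundary inclusions, in terms of elements\<close>

lemma natural_data_Cptd:
  assumes "\<And>i x. x \<in> Car X i \<Longrightarrow> s i x \<in> Car Y i"
    and "\<And>\<delta> x. \<lbrakk>\<delta> \<in> nonid I; x \<in> Car X (Tgt I \<delta>)\<rbrakk>
      \<Longrightarrow> Act Y \<delta> (s (Tgt I \<delta>) x) = s (Src I \<delta>) (Act X \<delta> x)"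
  shows "natural_data \<beta> (Cptd I X) Y s"
  using assms by (auto simp: natural_data_def)

lemma cptd_mor_iota:
  assumes "i \<in> sorts I \<alpha>"
  shows "cptd_mor I \<Sigma> (bd_disc I i) (disc I i) (iota I i)"
  unfolding bd_disc_def disc_def iota_def
  by (rule cptd_mor_Cptd_map[OF is_presheaf_bd_rep[OF assms]])
    (auto simp: presheaf_mor_def bd_rep_def rep_def restr_def nonid_Arr Comp_nonid Src_Comp Tgt_Comp)

text \<open>By the universal property and Yoneda, a morphism out of the free algebra on the disc of
  \<open>i\<close> is an element of sort \<open>i\<close>, and one out of the free algebra on its
  boundary is a compatible family of faces. A lifting square is thus an element \<open>z\<close>
  with a lift \<open>y\<close> of its boundary, and a diagonal is the element
  \<open>x\<close>.\<close>

lemma trivial_fibration_filler: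
  assumes tf: "trivial_fibration I \<alpha> \<Sigma> Y Z p"
    and i: "i \<in> sorts I \<alpha>" and z: "z \<in> Car Z i"
    and y: "\<And>\<delta>. \<lbrakk>\<delta> \<in> nonid I; Tgt I \<delta> = i\<rbrakk> \<Longrightarrow> y \<delta> \<in> Car Y (Src I \<delta>)"
    and py: "\<And>\<delta>. \<lbrakk>\<delta> \<in> nonid I; Tgt I \<delta> = i\<rbrakk> \<Longrightarrow> p (Src I \<delta>) (y \<delta>) = Act Z \<delta> z"
    and nat: "\<And>\<delta> \<delta>'. \<lbrakk>\<delta> \<in> nonid I; Tgt I \<delta> = i; \<delta>' \<in> nonid I; Tgt I \<delta>' = Src I \<delta>\<rbrakk>
      \<Longrightarrow> Act Y \<delta>' (y \<delta>) = y (Comp I \<delta> \<delta>')"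
  shows "\<exists>x\<in>Car Y i. p i x = z \<and> (\<forall>\<delta>\<in>nonid I. Tgt I \<delta> = i \<longrightarrow> Act Y \<delta> x = y \<delta>)"
proof -
  let ?S = "bd_disc I i :: ('i, 'm, 'f, 'b, 'm) cptd" and ?D = "disc I i :: ('i, 'm, 'f, 'b, 'm) cptd"
  let ?k = "K_map I \<Sigma> ?S (iota I i)"
  have Y: "is_alg I \<alpha> \<Sigma> Y" and Z: "is_alg I \<alpha> \<Sigma> Z" and p: "alg_mor I \<Sigma> Y Z p"
    and lift: "lifts I \<Sigma> (K I \<Sigma> ?S) (K I \<Sigma> ?D) ?k Y Z p"
    using tf i by (auto simp: trivial_fibration_def)
  have S: "computad I \<alpha> \<Sigma> ?S" and D: "computad I \<alpha> \<Sigma> ?D"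
    by (simp_all add: bd_disc_def disc_def computad_Cptd is_presheaf_bd_rep is_presheaf_rep i)
  define a where "a = restr (Car (K I \<Sigma> ?S)) (\<lambda>j. eval_trm \<Sigma> Y (\<lambda>j. y))"
  \<comment> \<open>The generator \<open>\<delta>\<close> of the disc goes to the face of
    \<open>z\<close> along it, in particular the identity to \<open>z\<close>.\<close>
  define b where "b = restr (Car (K I \<Sigma> ?D)) (\<lambda>j. eval_trm \<Sigma> Z (\<lambda>j \<delta>. Act Z \<delta> z))"
  have a: "alg_mor I \<Sigma> (K I \<Sigma> ?S) Y a"
    unfolding a_def
  proof (rule alg_mor_eval_trm[OF Y S])
    show "natural_data \<alpha> ?S Y (\<lambda>j. y)"
      unfolding bd_disc_def by (rule natural_data_Cptd) (auto simp: bd_rep_def y nat)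
  qed
  have b: "alg_mor I \<Sigma> (K I \<Sigma> ?D) Z b"
    unfolding b_def
  proof (rule alg_mor_eval_trm[OF Z D])
    show "natural_data \<alpha> ?D Z (\<lambda>j \<delta>. Act Z \<delta> z)"
      unfolding disc_def using is_alg_presheaf[OF Z] z
      by (intro natural_data_Cptd) (auto simp: rep_def is_presheaf_def nonid_Arr)
  qed
  have k: "alg_mor I \<Sigma> (K I \<Sigma> ?S) (K I \<Sigma> ?D) ?k"
    by (rule alg_mor_K_map[OF S D cptd_mor_iota[OF i]])
  have k_Var: "?k j (Var j \<delta>) = Var j \<delta>" and S_Var: "is_term I \<Sigma> ?S j (Var j \<delta>)"
    if "\<delta> \<in> Car (bd_rep I i) j" for j \<delta>
  proof -
    show "is_term I \<Sigma> ?S j (Var j \<delta>)"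
      using that by (auto simp: bd_disc_def intro: is_term.Var)
    then show "?k j (Var j \<delta>) = Var j \<delta>"
      using that by (simp add: K_map_def Term_map_apply iota_def Cptd_map_apply restr_apply)
  qed
  have D_Var: "is_term I \<Sigma> ?D j (Var j \<delta>)" if "\<delta> \<in> Car (rep I i) j" for j \<delta>
    using that by (auto simp: disc_def intro: is_term.Var)
  have bd_sub: "\<delta> \<in> Car (rep I i) j" if "\<delta> \<in> Car (bd_rep I i) j" for j \<delta>
    using that by (auto simp: bd_rep_def rep_def nonid_Arr)
  have "pcomp (K I \<Sigma> ?S) p a = pcomp (K I \<Sigma> ?S) b ?k"
  proof (rule alg_mor_K_unique[OF S])
    show "alg_mor I \<Sigma> (K I \<Sigma> ?S) Z (pcomp (K I \<Sigma> ?S) p a)"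
      by (rule alg_mor_pcomp[OF is_alg_K[OF S] a p])
    show "alg_mor I \<Sigma> (K I \<Sigma> ?S) Z (pcomp (K I \<Sigma> ?S) b ?k)"
      by (rule alg_mor_pcomp[OF is_alg_K[OF S] k b])
    fix j \<delta> assume "\<delta> \<in> Gen ?S j"
    then have d: "\<delta> \<in> Car (bd_rep I i) j" by (simp add: bd_disc_def)
    then show "pcomp (K I \<Sigma> ?S) p a j (Var j \<delta>) = pcomp (K I \<Sigma> ?S) b ?k j (Var j \<delta>)"
      using S_Var[OF d] D_Var[OF bd_sub[OF d]] k_Var[OF d] py[of \<delta>]
      by (auto simp: pcomp_apply a_def b_def restr_apply bd_rep_def)
  qed
  then obtain l where l: "alg_mor I \<Sigma> (K I \<Sigma> ?D) Y l" "pcomp (K I \<Sigma> ?S) l ?k = a"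
    "pcomp (K I \<Sigma> ?D) p l = b"
    using lift a b unfolding lifts_def by blast
  \<comment> \<open>The variable at the identity is the universal element of the disc; its image
    under the lift is the filler.\<close>
  let ?e = "Var i (Ident I i) :: ('i, 'f, 'b, 'm) trm"
  have iO: "i \<in> Obj I" using i by (simp add: sorts_def)
  then have e: "is_term I \<Sigma> ?D i ?e"
    by (intro D_Var) (simp add: rep_def Ident_Arr Src_Ident Tgt_Ident)
  note lp = alg_mor_presheaf_mor[OF l(1)]
  have "l i ?e \<in> Car Y i" using presheaf_mor_Car[OF lp] e by simp
  moreover have "p i (l i ?e) = z"
  proof -
    have "p i (l i ?e) = b i ?e" using e by (simp add: l(3)[symmetric] pcomp_apply)
    then show ?thesis
      using e iO z is_alg_presheaf[OF Z] by (simp add: b_def restr_apply is_presheaf_def)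
  qed
  moreover have "Act Y \<delta> (l i ?e) = y \<delta>" if d: "\<delta> \<in> nonid I" "Tgt I \<delta> = i" for \<delta>
  proof -
    have db: "\<delta> \<in> Car (bd_rep I i) (Src I \<delta>)" using d by (simp add: bd_rep_def)
    have "Act Y \<delta> (l i ?e) = l (Src I \<delta>) (tact I \<Sigma> ?D \<delta> ?e)"
      using presheaf_mor_Act[OF lp nonid_Arr[OF d(1)], of ?e] e d by simp
    \<comment> \<open>The face of the universal element along \<open>\<delta>\<close> is the
      variable \<open>\<delta>\<close>, which comes from the boundary, where \<open>l\<close>
      restricts to \<open>a\<close>.\<close>
    also have "tact I \<Sigma> ?D \<delta> ?e = Var (Src I \<delta>) \<delta>"
      using d Comp_Ident_left[of \<delta>] by (simp add: tact_nonid disc_def rep_def nonid_Arr)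
    also have "l (Src I \<delta>) (Var (Src I \<delta>) \<delta>) = a (Src I \<delta>) (Var (Src I \<delta>) \<delta>)"
      using S_Var[OF db] k_Var[OF db] by (simp add: l(2)[symmetric] pcomp_apply)
    also have "\<dots> = y \<delta>" using S_Var[OF db] by (simp add: a_def restr_apply)
    finally show ?thesis .
  qed
  ultimately show ?thesis by blast
qed

section \<open>Construction of the lift by recursion on dimension\<close>

lemma Glue_term_tr:
  assumes "computad I \<alpha> \<Sigma> C" "\<delta> \<in> nonid I" "v \<in> Gen C (Tgt I \<delta>)"
  shows "is_term I (tr_sig I (Dim I (Src I \<delta>)) \<Sigma>) (tr_cptd I (Dim I (Src I \<delta>)) C)
    (Src I \<delta>) (Glue C \<delta> v)"
  using assms unfolding computad_def Let_def by auto

lemma K_lift: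
  fixes Y :: "('i, 'm, 'f, 'b, 'y) alg" and C :: "('i, 'm, 'f, 'b, 'v) cptd"
  assumes tf: "trivial_fibration I \<alpha> \<Sigma> Y Z p" and C: "computad I \<alpha> \<Sigma> C"
    and b: "alg_mor I \<Sigma> (K I \<Sigma> C) Z b"
  shows "\<exists>l. alg_mor I \<Sigma> (K I \<Sigma> C) Y l \<and> pcomp (K I \<Sigma> C) p l = b"
proof -
  have Y: "is_alg I \<alpha> \<Sigma> Y" and Z: "is_alg I \<alpha> \<Sigma> Z" and p: "alg_mor I \<Sigma> Y Z p"
    using tf by (auto simp: trivial_fibration_def)
  \<comment> \<open>\<open>P s i r\<close> states that \<open>r\<close> is a correct choice of
    images at sort \<open>i\<close>: it lies over \<open>b\<close>, and its faces are those
    prescribed by the choices \<open>s\<close>.\<close>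
  define P where "P = (\<lambda>s i r. \<forall>v\<in>Gen C i. r v \<in> Car Y i \<and> p i (r v) = b i (Var i v) \<and>
    (\<forall>\<delta>\<in>nonid I. Tgt I \<delta> = i \<longrightarrow> Act Y \<delta> (r v) = eval_trm \<Sigma> Y s (Glue C \<delta> v)))"
  define R where "R = inv_image {(x, y :: 'o). x < y} (Dim I)"
  have "wf R" unfolding R_def by (intro wf_inv_image wf)
  \<comment> \<open>Two obligations arise: \<open>P s i\<close> depends on \<open>s\<close> only at
    sorts of smaller dimension, and choices correct there extend to \<open>i\<close>.\<close>
  then have "\<exists>s. \<forall>i. P s i (s i)"
  proof (rule dependent_wf_choice)
    fix s s' :: "'i \<Rightarrow> 'v \<Rightarrow> 'y" and i r
    assume eq: "\<And>j. (j, i) \<in> R \<Longrightarrow> s j = s' j"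
    have "eval_trm \<Sigma> Y s (Glue C \<delta> v) = eval_trm \<Sigma> Y s' (Glue C \<delta> v)"
      if d: "\<delta> \<in> nonid I" "Tgt I \<delta> = i" "v \<in> Gen C i" for \<delta> v
    proof -
      \<comment> \<open>\<open>Glue_term_tr\<close> confines the gluing term to generators of
        dimension at most that of the source of \<open>\<delta>\<close>, strictly below that of
        \<open>i\<close>, where the two choices agree.\<close>
      have "s j w = s' j w" if "j \<in> sorts I (Dim I (Src I \<delta>))" for j w
        using that Dim_less[OF d(1)] d eq[of j] by (auto simp: sorts_def R_def)
      then have "eval_trm (tr_sig I (Dim I (Src I \<delta>)) \<Sigma>) Y s (Glue C \<delta> v) =
          eval_trm (tr_sig I (Dim I (Src I \<delta>)) \<Sigma>) Y s' (Glue C \<delta> v)"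
        using d by (intro eval_trm_cong[OF Glue_term_tr[OF C d(1)]]) (auto split: if_splits)
      then show ?thesis by simp
    qed
    then show "P s i r = P s' i r" unfolding P_def by (metis (no_types, lifting))
  next
    fix i and s :: "'i \<Rightarrow> 'v \<Rightarrow> 'y"
    assume low: "\<And>j. (j, i) \<in> R \<Longrightarrow> P s j (s j)"
    have "\<exists>x\<in>Car Y i. p i x = b i (Var i v) \<and>
      (\<forall>\<delta>\<in>nonid I. Tgt I \<delta> = i \<longrightarrow> Act Y \<delta> x = eval_trm \<Sigma> Y s (Glue C \<delta> v))"
      if v: "v \<in> Gen C i" for v
    proof (rule trivial_fibration_filler[OF tf Gen_sorts[OF C v]])
      have tv: "is_term I \<Sigma> C i (Var i v)" using v by (rule is_term.Var)
      then show "b i (Var i v) \<in> Car Z i"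
        using presheaf_mor_Car[OF alg_mor_presheaf_mor[OF b]] by simp
      fix \<delta> assume d: "\<delta> \<in> nonid I" "Tgt I \<delta> = i"
      let ?\<beta> = "Dim I (Src I \<delta>)"
      have j: "Src I \<delta> \<in> sorts I ?\<beta>" using d by (simp add: sorts_def Src_Obj nonid_Arr)
      have lowd: "P s j (s j)" if "j \<in> sorts I ?\<beta>" for j
        using that low Dim_less[OF d(1)] d(2) by (auto simp: sorts_def R_def)
      \<comment> \<open>The bound is the dimension of the source of \<open>\<delta>\<close>, where
        the choices are already correct; images at the sort \<open>i\<close> are still to be
        found.\<close>
      have s: "natural_data ?\<beta> C Y s" using lowd by (simp add: natural_data_def P_def)
      have G: "is_term I \<Sigma> C (Src I \<delta>) (Glue C \<delta> v)"
        using Glue_term[OF C d(1)] d v by simp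
      note e = eval_trm_natural[OF Y s G j]
      from e show "eval_trm \<Sigma> Y s (Glue C \<delta> v) \<in> Car Y (Src I \<delta>)" ..
      have "p (Src I \<delta>) (eval_trm \<Sigma> Y s (Glue C \<delta> v)) = b (Src I \<delta>) (Glue C \<delta> v)"
        by (rule alg_mor_eval_trm_eq[OF Y p C b s _ G j]) (use lowd in \<open>simp add: P_def\<close>)
      also have "\<dots> = Act Z \<delta> (b i (Var i v))"
        using presheaf_mor_Act[OF alg_mor_presheaf_mor[OF b] nonid_Arr[OF d(1)], of "Var i v"] tv d
        by (simp add: tact_nonid)
      finally show "p (Src I \<delta>) (eval_trm \<Sigma> Y s (Glue C \<delta> v)) = Act Z \<delta> (b i (Var i v))" .
      fix \<delta>' assume d': "\<delta>' \<in> nonid I" "Tgt I \<delta>' = Src I \<delta>"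
      then show "Act Y \<delta>' (eval_trm \<Sigma> Y s (Glue C \<delta> v)) = eval_trm \<Sigma> Y s (Glue C (Comp I \<delta> \<delta>') v)"
        using e Glue_Comp[OF C d(1), of v \<delta>'] d v by (simp add: nonid_Arr)
    qed
    then show "\<exists>r. P s i r" unfolding P_def by metis
  qed
  then obtain s where s: "\<And>i. P s i (s i)" by blast
  have nat: "natural_data \<alpha> C Y s" using s by (simp add: natural_data_def P_def)
  let ?l = "restr (Car (K I \<Sigma> C)) (\<lambda>i. eval_trm \<Sigma> Y s)"
  have l: "alg_mor I \<Sigma> (K I \<Sigma> C) Y ?l" by (rule alg_mor_eval_trm[OF Y C nat])
  have "pcomp (K I \<Sigma> C) p ?l = b"
  proof (rule alg_mor_K_unique[OF C _ b])
    show "alg_mor I \<Sigma> (K I \<Sigma> C) Z (pcomp (K I \<Sigma> C) p ?l)"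
      by (rule alg_mor_pcomp[OF is_alg_K[OF C] l p])
    show "pcomp (K I \<Sigma> C) p ?l i (Var i v) = b i (Var i v)" if "v \<in> Gen C i" for i v
      using that s[of i] by (simp add: pcomp_apply restr_apply P_def is_term.Var)
  qed
  with l show ?thesis by blast
qed

end

theorem proposition19:
  fixes I :: "('i, 'm, 'o::wellorder) direct_cat"
    and \<alpha> :: 'o
    and \<Sigma> :: "('i, 'm, 'f, 'b) sig"
    and C :: "('i, 'm, 'f, 'b, 'v) cptd"
  assumes "direct_category I"
    and "signature I \<alpha> \<Sigma>"
    and "computad I \<alpha> \<Sigma> C"
  shows "cofibrant TYPE('y) TYPE('z) I \<alpha> \<Sigma> (K I \<Sigma> C)"
proof -
  interpret sorted_signature I \<alpha> \<Sigma>
    using assms(1,2) by (simp add: sorted_signature_def sorted_signature_axioms_def)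
  note A = is_alg_initial_alg and KC = is_alg_K[OF assms(3)]
  \<comment> \<open>This is the description occurring in \<open>cofibrant\<close>; initiality makes
    it denote an actual morphism.\<close>
  define k where "k = (THE h. alg_mor I \<Sigma> (initial_alg I \<Sigma>) (K I \<Sigma> C) h)"
  have k: "alg_mor I \<Sigma> (initial_alg I \<Sigma>) (K I \<Sigma> C) k"
    unfolding k_def by (rule theI'[OF initial_alg_ex1[OF KC]])
  have "lifts I \<Sigma> (initial_alg I \<Sigma>) (K I \<Sigma> C) k Y Z p"
    if tf: "trivial_fibration I \<alpha> \<Sigma> Y Z p"
    for Y :: "('i, 'm, 'f, 'b, 'y) alg" and Z :: "('i, 'm, 'f, 'b, 'z) alg" and p
    unfolding lifts_def
  proof (intro allI impI, elim conjE)
    fix a b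
    assume a: "alg_mor I \<Sigma> (initial_alg I \<Sigma>) Y a" and b: "alg_mor I \<Sigma> (K I \<Sigma> C) Z b"
    have Y: "is_alg I \<alpha> \<Sigma> Y" using tf by (simp add: trivial_fibration_def)
    obtain l where l: "alg_mor I \<Sigma> (K I \<Sigma> C) Y l" "pcomp (K I \<Sigma> C) p l = b"
      using K_lift[OF tf assms(3) b] by blast
    have "alg_mor I \<Sigma> (initial_alg I \<Sigma>) Y (pcomp (initial_alg I \<Sigma>) l k)"
      by (rule alg_mor_pcomp[OF A k l(1)])
    then have "pcomp (initial_alg I \<Sigma>) l k = a"
      using initial_alg_ex1[OF Y] a by blast
    with l show "\<exists>l. alg_mor I \<Sigma> (K I \<Sigma> C) Y l \<and> pcomp (initial_alg I \<Sigma>) l k = a \<and>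
        pcomp (K I \<Sigma> C) p l = b"
      by blast
  qed
  then show ?thesis
    using A KC k unfolding cofibrant_def cofibration_def k_def by blast
qed

end
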